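(* Let $C$ be the non-complete intersection Gorenstein monomial curve $x_i=t^{n_i}$ ($1\le i\le4$) in $\mathbb{A}^4(K)$, with $n_1<n_2<n_3<n_4$. Suppose that $I(C)$ is given as in case 2(a), i.e. $I(C)$ is minimally generated by $$f_1=x_1^{a_1}-x_2^{a_{12}}x_3^{a_{13}},\quad f_2=x_2^{a_2}-x_3^{a_{23}}x_4^{a_{24}},\quad f_3=x_3^{a_3}-x_1^{a_{31}}x_4^{a_{34}},$$ $$f_4=x_4^{a_4}-x_1^{a_{41}}x_2^{a_{42}},\quad f_5=x_1^{a_{41}}x_3^{a_{23}}-x_2^{a_{12}}x_4^{a_{34}},$$ and also that $a_{24}<a_{34}$. Assume that $a_{13}\le a_{23}$. Then $C$ has Cohen-Macaulay tangent cone at the origin if and only if (1) $a_3\le a_{31}+a_{34}$, (2) $a_{12}+a_{34}\le a_{41}+a_{23}$, and (3) $a_2+a_{12}\le a_1+a_{23}-a_{13}+a_{24}$.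
   Context: $K$ is a field and $n_1,\dots,n_4$ are positive integers with $\gcd(n_1,\dots,n_4)=1$. $I(C)$ is the kernel of the $K$-algebra homomorphism $K[x_1,\dots,x_4]\to K[t]$, $x_i\mapsto t^{n_i}$. $C$ is Gorenstein if the semigroup $\mathcal{S}=\{g_1n_1+\cdots+g_4n_4: g_i\in\mathbb{N}\}$ is symmetric ($\mathbb{N}$ = non-negative integers). In the description of $I(C)$, all exponents are integers with $0<a_{ij}<a_j$, and (by Bresinsky) $a_1=a_{31}+a_{41}$, $a_2=a_{12}+a_{42}$, $a_3=a_{13}+a_{23}$, $a_4=a_{24}+a_{34}$. $C$ has Cohen-Macaulay tangent cone at the origin if the ring $K[x_1,\dots,x_4]/I(C)_*$ is Cohen-Macaulay, where $I(C)_*$ is generated by the homogeneous (standard grading) summands $f_*$ of least degree of the polynomials $f\in I(C)$. *)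

theory Defs
  imports
    "HOL-Library.Numeral_Type"
    "HOL-Library.Poly_Mapping"
    "HOL-Library.Extended_Nat"
    "HOL-Computational_Algebra.Polynomial"
    "HOL-Algebra.Algebra"
    "HOL-Algebra.Algebraic_Closure_Type"
begin

section \<open>Cohen--Macaulay rings\<close>

text \<open>
  An \<open>R\<close>-sequence: every entry is a nonzerodivisor modulo the ideal generated by the earlier
  ones, and the whole sequence generates a proper ideal.
\<close>

definition regular_sequence :: "('a, 'm) ring_scheme \<Rightarrow> 'a list \<Rightarrow> bool" where
  "regular_sequence R xs \<longleftrightarrow>
     set xs \<subseteq> carrier R \<and>
     (\<forall>i < length xs. \<forall>y \<in> carrier R.
        xs ! i \<otimes>\<^bsub>R\<^esub> y \<in> Idl\<^bsub>R\<^esub> (set (take i xs)) \<longrightarrow> y \<in> Idl\<^bsub>R\<^esub> (set (take i xs))) \<and>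
     Idl\<^bsub>R\<^esub> (set xs) \<noteq> carrier R"

definition ideal_depth :: "('a, 'm) ring_scheme \<Rightarrow> 'a set \<Rightarrow> enat" where
  "ideal_depth R I = Sup {enat (length xs) | xs. regular_sequence R xs \<and> set xs \<subseteq> I}"

text \<open>
  The codimension (height) of a prime is the supremum of the lengths \<open>r\<close> of chains
  \<open>Q 0 \<subset> \<dots> \<subset> Q r = P\<close> of primes; that of an ideal is the infimum over the primes
  containing it.
\<close>

definition prime_codim :: "('a, 'm) ring_scheme \<Rightarrow> 'a set \<Rightarrow> enat" where
  "prime_codim R P = Sup {enat r | r Q. (\<forall>i \<le> r. primeideal (Q i) R) \<and>
                                        (\<forall>i < r. Q i \<subset> Q (Suc i)) \<and> Q r = P}"

definition ideal_codim :: "('a, 'm) ring_scheme \<Rightarrow> 'a set \<Rightarrow> enat" where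
  "ideal_codim R I = Inf {prime_codim R P | P. primeideal P R \<and> I \<subseteq> P}"

text \<open>
  Eisenbud, \<^emph>\<open>Commutative Algebra\<close>, Section 18.2: a Noetherian commutative ring is
  Cohen--Macaulay if depth and codimension agree for each of its maximal ideals.
\<close>

definition cohen_macaulay :: "('a, 'm) ring_scheme \<Rightarrow> bool" where
  "cohen_macaulay R \<longleftrightarrow> cring R \<and> noetherian_ring R \<and>
     (\<forall>P. maximalideal P R \<longrightarrow> ideal_depth R P = prime_codim R P)"


section \<open>Polynomials in several variables\<close>

text \<open>
  A polynomial over \<open>'k\<close> in the variables \<open>'v\<close> maps each monomial, i.e. each exponent vector in
  \<open>'v \<Rightarrow>\<^sub>0 nat\<close>, to its coefficient.
\<close>

type_synonym ('v, 'k) mpoly = "('v \<Rightarrow>\<^sub>0 nat) \<Rightarrow>\<^sub>0 'k"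

abbreviation mpoly_ring :: "('v, 'k :: comm_ring_1) mpoly ring" where
  "mpoly_ring \<equiv> ring_of_type_algebra"

definition mvar :: "'v \<Rightarrow> ('v, 'k :: comm_ring_1) mpoly" where
  "mvar i = Poly_Mapping.single (Poly_Mapping.single i 1) 1"

definition mono_deg :: "('v :: finite \<Rightarrow>\<^sub>0 nat) \<Rightarrow> nat" where
  "mono_deg m = (\<Sum>i\<in>UNIV. Poly_Mapping.lookup m i)"

definition hom_component :: "nat \<Rightarrow> ('v :: finite, 'k :: comm_ring_1) mpoly \<Rightarrow> ('v, 'k) mpoly" where
  "hom_component d f = (\<Sum>m \<in> {m \<in> Poly_Mapping.keys f. mono_deg m = d}.
     Poly_Mapping.single m (Poly_Mapping.lookup f m))"

text \<open>The value of \<open>Min {}\<close> is irrelevant: \<open>initial_form 0 = 0\<close> in any case.\<close>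

definition initial_form :: "('v :: finite, 'k :: comm_ring_1) mpoly \<Rightarrow> ('v, 'k) mpoly" where
  "initial_form f = hom_component (Min (mono_deg ` Poly_Mapping.keys f)) f"

definition initial_ideal :: "('v :: finite, 'k :: comm_ring_1) mpoly set \<Rightarrow> ('v, 'k) mpoly set" where
  "initial_ideal I = Idl\<^bsub>mpoly_ring\<^esub> (initial_form ` I)"

definition minimally_generates ::
  "('v, 'k :: comm_ring_1) mpoly set \<Rightarrow> ('v, 'k) mpoly set \<Rightarrow> bool" where
  "minimally_generates F I \<longleftrightarrow>
     Idl\<^bsub>mpoly_ring\<^esub> F = I \<and> (\<forall>G. G \<subset> F \<longrightarrow> Idl\<^bsub>mpoly_ring\<^esub> G \<noteq> I)"


section \<open>Monomial curves\<close>

text \<open>The curve \<open>x\<^sub>i = t ^ n i\<close> is represented by its exponents \<open>n\<close>.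
  A curve in affine 4-space is indexed by the numeral type \<open>4\<close>, whose elements
  are \<open>1, 2, 3, 4\<close> (with \<open>4 = 0\<close>).\<close>

definition curve_hom :: "('v :: finite \<Rightarrow> nat) \<Rightarrow> ('v, 'k :: comm_ring_1) mpoly \<Rightarrow> 'k poly" where
  "curve_hom n f = (\<Sum>m \<in> Poly_Mapping.keys f.
     Polynomial.smult (Poly_Mapping.lookup f m)
       (\<Prod>i\<in>UNIV. (Polynomial.monom 1 (n i)) ^ Poly_Mapping.lookup m i))"

definition curve_ideal :: "('v :: finite \<Rightarrow> nat) \<Rightarrow> ('v, 'k :: comm_ring_1) mpoly set" where
  "curve_ideal n = {f. curve_hom n f = 0}"

definition curve_semigroup :: "('v :: finite \<Rightarrow> nat) \<Rightarrow> nat set" where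
  "curve_semigroup n = {\<Sum>i\<in>UNIV. g i * n i | g. True}"

text \<open>The largest integer outside \<open>S\<close>, which exists if the generators of \<open>S\<close> have
  greatest common divisor 1; it is \<open>-1\<close> if \<open>S\<close> consists of all natural numbers.\<close>

definition frobenius_number :: "nat set \<Rightarrow> int" where
  "frobenius_number S = (GREATEST z. z \<notin> int ` S)"

definition symmetric_semigroup :: "nat set \<Rightarrow> bool" where
  "symmetric_semigroup S \<longleftrightarrow>
     (\<forall>z. z \<in> int ` S \<longleftrightarrow> frobenius_number S - z \<notin> int ` S)"

definition gorenstein_curve :: "('v :: finite \<Rightarrow> nat) \<Rightarrow> bool" where
  "gorenstein_curve n \<longleftrightarrow> symmetric_semigroup (curve_semigroup n)"

text \<open>A complete intersection ideal is generated by as many elements as its codimension.\<close>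

definition complete_intersection :: "('v, 'k :: comm_ring_1) mpoly set \<Rightarrow> bool" where
  "complete_intersection I \<longleftrightarrow>
     (\<exists>F. finite F \<and> enat (card F) = ideal_codim mpoly_ring I \<and> Idl\<^bsub>mpoly_ring\<^esub> F = I)"

definition cohen_macaulay_tangent_cone :: "('v :: finite, 'k :: comm_ring_1) mpoly set \<Rightarrow> bool" where
  "cohen_macaulay_tangent_cone I \<longleftrightarrow> cohen_macaulay (mpoly_ring Quot initial_ideal I)"

end

theory Submission imports Defs begin

text \<open>
  Write \<open>x\<^sub>1, \<dots>, x\<^sub>4\<close> for the variables, let the \<^emph>\<open>weight\<close> of a monomial be the exponent of its
  image in \<open>K[t]\<close>, and call the set of all monomials of one weight a \<^emph>\<open>fibre\<close>.  The ideal of the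
  curve is spanned by the differences of monomials of the same fibre.  Taking initial forms, a
  monomial that does not have the largest degree in its fibre becomes zero in the tangent cone, and
  the monomials of largest degree in a fibre are identified (\<open>initial_ideal_curve_ideal\<close>).  So the
  tangent cone has a basis indexed by the semigroup, and its multiplication is visible on monomials.

  Every variable except \<open>x\<^sub>1\<close>, which has the lowest weight, is nilpotent in the tangent cone \<open>A\<close>:
  the monomials \<open>x\<^sub>j ^ n\<^sub>1\<close> and \<open>x\<^sub>1 ^ n\<^sub>j\<close> have the same weight and the second one has the larger
  degree.  Hence \<open>A\<close> is finite over \<open>K[x\<^sub>1]\<close> and \<open>K[x\<^sub>1]\<close> is its reduction.  It follows that
  \<open>A\<close> is Noetherian, that all its maximal ideals have height one, and that regular sequences have
  length at most one.  Thus \<open>A\<close> is Cohen--Macaulay if and only if each maximal ideal contains a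
  nonzerodivisor, and this holds if and only if \<open>x\<^sub>1\<close> is a nonzerodivisor (\<open>cohen_macaulay_iff\<close>).  In
  terms of monomials: if a monomial has the largest degree in its fibre, then so has its product with
  \<open>x\<^sub>1\<close> (\<open>cohen_macaulay_tangent_cone_iff\<close>).

  It remains to relate this condition to the exponents (\<open>order_condition_iff\<close>).
  Suppose that one of the three inequalities fails.  There is a monomial \<open>x\<^sub>1 ^ k \<cdot> m\<close>, namely one of
  \<open>x\<^sub>1 ^ a31 \<cdot> x\<^sub>4 ^ a34\<close>, \<open>x\<^sub>1 ^ a41 \<cdot> x\<^sub>3 ^ a23\<close>, \<open>x\<^sub>1 ^ a1 \<cdot> x\<^sub>3 ^ (a23 - a13) \<cdot> x\<^sub>4 ^ a24\<close>, that does not have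
  the largest degree in its fibre, although \<open>m\<close> is alone in its fibre because no term of the given
  generators divides it.

  Conversely, orient the five generators, together with
  \<open>f\<^sub>6 = x\<^sub>2 ^ (a2 + a12) - x\<^sub>1 ^ a1 \<cdot> x\<^sub>3 ^ (a23 - a13) \<cdot> x\<^sub>4 ^ a24\<close>, as rewrite rules that never decrease the
  exponent of \<open>x\<^sub>1\<close>.  The rules terminate and are confluent, so each fibre has
  a unique normal form; and \<open>x\<^sub>1\<close> times a normal form is a normal form.  Three of the rules never
  decrease the degree because \<open>n\<^sub>1 < n\<^sub>2 < n\<^sub>3 < n\<^sub>4\<close>; that the other three do not is what the
  inequalities say.  So the normal form has the largest degree in its fibre, and the
  condition follows.
\<close>

section \<open>Sums of coefficients over sets of monomials\<close>

definition coeff_sum :: "('m \<Rightarrow> bool) \<Rightarrow> ('m \<Rightarrow>\<^sub>0 'k :: comm_monoid_add) \<Rightarrow> 'k" where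
  "coeff_sum P f = (\<Sum>m \<in> {m \<in> Poly_Mapping.keys f. P m}. Poly_Mapping.lookup f m)"

lemma coeff_sum_superset:
  assumes "finite A" "Poly_Mapping.keys f \<subseteq> A"
  shows "coeff_sum P f = (\<Sum>m\<in>A. if P m then Poly_Mapping.lookup f m else 0)"
proof -
  have "coeff_sum P f = (\<Sum>m\<in>Poly_Mapping.keys f. if P m then Poly_Mapping.lookup f m else 0)"
    unfolding coeff_sum_def by (rule sum.inter_filter) simp
  also have "\<dots> = (\<Sum>m\<in>A. if P m then Poly_Mapping.lookup f m else 0)"
    by (rule sum.mono_neutral_left) (use assms in \<open>auto simp: in_keys_iff\<close>)
  finally show ?thesis .
qed

lemma coeff_sum_zero [simp]: "coeff_sum P 0 = 0"
  by (simp add: coeff_sum_def)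

lemma coeff_sum_single [simp]: "coeff_sum P (Poly_Mapping.single m a) = (if P m then a else 0)"
  by (subst coeff_sum_superset[of "{m}"]) auto

lemma coeff_sum_add [simp]: "coeff_sum P (f + g) = coeff_sum P f + coeff_sum P g"
proof -
  let ?A = "Poly_Mapping.keys f \<union> Poly_Mapping.keys g"
  have "coeff_sum P (f + g) = (\<Sum>m\<in>?A. if P m then Poly_Mapping.lookup (f + g) m else 0)"
    using keys_add[of f g] by (intro coeff_sum_superset) auto
  also have "\<dots> = (\<Sum>m\<in>?A. if P m then Poly_Mapping.lookup f m else 0) +
      (\<Sum>m\<in>?A. if P m then Poly_Mapping.lookup g m else 0)"
    unfolding sum.distrib[symmetric] by (rule sum.cong) (auto simp: lookup_add)
  also have "\<dots> = coeff_sum P f + coeff_sum P g"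
    by (simp add: coeff_sum_superset[of ?A])
  finally show ?thesis .
qed

lemma coeff_sum_diff [simp]:
  fixes f g :: "'m \<Rightarrow>\<^sub>0 'k :: ab_group_add"
  shows "coeff_sum P (f - g) = coeff_sum P f - coeff_sum P g"
  using coeff_sum_add[of P "f - g" g] by (simp add: algebra_simps)

lemma coeff_sum_sum: "coeff_sum P (sum h A) = (\<Sum>i\<in>A. coeff_sum P (h i))"
  by (induction A rule: infinite_finite_induct) auto

lemma sum_of_monomials:
  "f = (\<Sum>m\<in>Poly_Mapping.keys f. Poly_Mapping.single m (Poly_Mapping.lookup f m))"
  by (rule poly_mapping_eqI) (simp add: lookup_sum lookup_single when_def in_keys_iff)

lemma mpoly_induct [case_names single add]:
  fixes f :: "'m \<Rightarrow>\<^sub>0 'k :: comm_monoid_add"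
  assumes "\<And>m a. P (Poly_Mapping.single m a)"
    and "\<And>f g. P f \<Longrightarrow> P g \<Longrightarrow> P (f + g)"
  shows "P f"
proof -
  have "P (\<Sum>m\<in>A. Poly_Mapping.single m (Poly_Mapping.lookup f m))" if "finite A" for A
    using that
  proof (induction A rule: finite_induct)
    case empty
    show ?case using assms(1)[of undefined 0] by simp
  qed (simp add: assms)
  from this[OF finite_keys, of f] show ?thesis by (simp flip: sum_of_monomials)
qed

lemma coeff_sum_single_mult:
  fixes f :: "'m :: comm_monoid_add \<Rightarrow>\<^sub>0 'k :: comm_semiring_0"
  shows "coeff_sum P (Poly_Mapping.single w a * f) = a * coeff_sum (\<lambda>m. P (w + m)) f"
  by (induction f rule: mpoly_induct) (auto simp: mult_single ring_distribs distrib_left)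

section \<open>Ideals of polynomials that vanish on classes of monomials\<close>

lemma ring_of_type_algebra_simps [simp]:
  "carrier (ring_of_type_algebra :: 'a :: comm_ring_1 ring) = UNIV"
  "x \<otimes>\<^bsub>ring_of_type_algebra\<^esub> y = x * y"
  "x \<oplus>\<^bsub>ring_of_type_algebra\<^esub> y = x + y"
  "\<zero>\<^bsub>ring_of_type_algebra :: 'a ring\<^esub> = 0"
  "\<one>\<^bsub>ring_of_type_algebra :: 'a ring\<^esub> = 1"
  by (auto simp: ring_of_type_algebra_def)

lemma ideal_type_algebraI:
  fixes I :: "'a :: comm_ring_1 set"
  assumes "0 \<in> I" "\<And>a b. a \<in> I \<Longrightarrow> b \<in> I \<Longrightarrow> a + b \<in> I" "\<And>r a. a \<in> I \<Longrightarrow> r * a \<in> I"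
  shows "ideal I ring_of_type_algebra"
proof (rule idealI)
  interpret R: ring "ring_of_type_algebra :: 'a ring" by rule
  show "ring (ring_of_type_algebra :: 'a ring)" by rule
  show "subgroup I (add_monoid (ring_of_type_algebra :: 'a ring))"
  proof (rule R.add.subgroupI)
    fix a assume "a \<in> I"
    have "\<ominus>\<^bsub>ring_of_type_algebra\<^esub> a = - a" by (rule R.minus_equality) auto
    then show "\<ominus>\<^bsub>ring_of_type_algebra\<^esub> a \<in> I" using assms(3)[OF \<open>a \<in> I\<close>, of "-1"] by simp
  qed (use assms in auto)
qed (use assms in \<open>auto simp: mult.commute\<close>)

lemma ideal_type_algebraD:
  fixes I :: "'a :: comm_ring_1 set"
  assumes "ideal I ring_of_type_algebra"
  shows "0 \<in> I" "a \<in> I \<Longrightarrow> b \<in> I \<Longrightarrow> a + b \<in> I" "a \<in> I \<Longrightarrow> r * a \<in> I"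
    "a \<in> I \<Longrightarrow> b \<in> I \<Longrightarrow> a - b \<in> I" "(\<And>i. i \<in> A \<Longrightarrow> h i \<in> I) \<Longrightarrow> sum h A \<in> I"
proof -
  note I_subgroup = ideal.axioms(1)[OF assms]
  show 0: "0 \<in> I" using additive_subgroup.zero_closed[OF I_subgroup] by simp
  show add: "a \<in> I \<Longrightarrow> b \<in> I \<Longrightarrow> a + b \<in> I" for a b using additive_subgroup.a_closed[OF I_subgroup, of a b] by simp
  show mult: "a \<in> I \<Longrightarrow> r * a \<in> I" for r a using ideal.I_l_closed[OF assms] by simp
  show "a \<in> I \<Longrightarrow> b \<in> I \<Longrightarrow> a - b \<in> I" using add[of a "-1 * b"] mult[of b "-1"] by simp
  show "(\<And>i. i \<in> A \<Longrightarrow> h i \<in> I) \<Longrightarrow> sum h A \<in> I"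
    by (induction A rule: infinite_finite_induct) (auto intro: 0 add)
qed

lemmas genideal_type_algebra_minimal = ring.genideal_minimal[OF ring_from_type_algebra]

lemma genideal_type_algebra:
  fixes S :: "'a :: comm_ring_1 set"
  shows "ideal (Idl\<^bsub>ring_of_type_algebra\<^esub> S) ring_of_type_algebra"
    and "S \<subseteq> Idl\<^bsub>ring_of_type_algebra\<^esub> S"
  by (rule ring.genideal_ideal[OF ring_from_type_algebra]
      ring.genideal_self[OF ring_from_type_algebra]; simp)+

text \<open>
  A congruence on the monoid of monomials, given by a map to classes; \<open>None\<close> is the class of the
  monomials that are to become zero and is therefore absorbing.
\<close>

definition monomial_congruence :: "('m :: comm_monoid_add \<Rightarrow> 'c option) \<Rightarrow> bool" where
  "monomial_congruence \<kappa> \<longleftrightarrow>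
     (\<forall>u v w. \<kappa> u = \<kappa> v \<longrightarrow> \<kappa> (w + u) = \<kappa> (w + v)) \<and> (\<forall>u w. \<kappa> u = None \<longrightarrow> \<kappa> (w + u) = None)"

definition congruence_ideal ::
  "('m :: comm_monoid_add \<Rightarrow> 'c option) \<Rightarrow> ('m \<Rightarrow>\<^sub>0 'k :: comm_ring_1) set" where
  "congruence_ideal \<kappa> = {f. \<forall>c. coeff_sum (\<lambda>m. \<kappa> m = Some c) f = 0}"

text \<open>
  A set of monomials that is a union of classes, none of them \<open>None\<close>, splits the sum of its
  coefficients into class sums.
\<close>

lemma coeff_sum_union_of_classes:
  assumes f: "f \<in> congruence_ideal \<kappa>"
    and P: "\<And>u v. \<kappa> u = \<kappa> v \<Longrightarrow> P u = P v" "\<And>u. P u \<Longrightarrow> \<kappa> u \<noteq> None"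
  shows "coeff_sum P f = 0"
proof -
  let ?S = "{m \<in> Poly_Mapping.keys f. P m}"
  have "coeff_sum P f = (\<Sum>c\<in>\<kappa> ` ?S. \<Sum>m | m \<in> ?S \<and> \<kappa> m = c. Poly_Mapping.lookup f m)"
    unfolding coeff_sum_def by (rule sum.group[symmetric]) auto
  also have "\<dots> = 0"
  proof (rule sum.neutral, safe)
    fix m assume m: "m \<in> Poly_Mapping.keys f" "P m"
    then obtain c where c: "\<kappa> m = Some c" using P(2)[OF m(2)] by auto
    have "{u \<in> ?S. \<kappa> u = \<kappa> m} = {u \<in> Poly_Mapping.keys f. \<kappa> u = Some c}"
      using P(1)[of _ m] m(2) c by auto
    then show "(\<Sum>u | u \<in> ?S \<and> \<kappa> u = \<kappa> m. Poly_Mapping.lookup f u) = 0"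
      using f by (simp add: congruence_ideal_def coeff_sum_def)
  qed
  finally show ?thesis .
qed

lemma ideal_congruence_ideal:
  assumes "monomial_congruence \<kappa>"
  shows "ideal (congruence_ideal \<kappa> :: ('m :: comm_monoid_add \<Rightarrow>\<^sub>0 'k :: comm_ring_1) set)
    ring_of_type_algebra"
proof (rule ideal_type_algebraI)
  fix r f :: "'m \<Rightarrow>\<^sub>0 'k"
  assume f: "f \<in> congruence_ideal \<kappa>"
  show "r * f \<in> congruence_ideal \<kappa>"
  proof (induction r rule: mpoly_induct)
    case (single w a)
    have "coeff_sum (\<lambda>m. \<kappa> (w + m) = Some c) f = 0" for c
    proof (rule coeff_sum_union_of_classes[OF f])
      show "(\<kappa> (w + u) = Some c) = (\<kappa> (w + v) = Some c)" if "\<kappa> u = \<kappa> v" for u v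
        using assms that unfolding monomial_congruence_def by metis
      show "\<kappa> u \<noteq> None" if "\<kappa> (w + u) = Some c" for u
        using assms that unfolding monomial_congruence_def by (metis option.distinct(1))
    qed
    then show ?case by (simp add: congruence_ideal_def coeff_sum_single_mult)
  qed (simp add: congruence_ideal_def distrib_right)
qed (auto simp: congruence_ideal_def)

lemma single_mem_congruence_ideal:
  "Poly_Mapping.single u a \<in> congruence_ideal \<kappa> \<longleftrightarrow> \<kappa> u = None \<or> a = 0"
  by (cases "\<kappa> u") (auto simp: congruence_ideal_def)

lemma binomial_mem_congruence_ideal:
  "Poly_Mapping.single u 1 - Poly_Mapping.single v 1 \<in> congruence_ideal \<kappa> \<longleftrightarrow> \<kappa> u = \<kappa> v"
  by (cases "\<kappa> u"; cases "\<kappa> v") (auto simp: congruence_ideal_def)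

text \<open>
  Replace each monomial of \<open>f\<close> by a fixed representative of its class, or by zero if its class is
  \<open>None\<close>.  This changes \<open>f\<close> by an element of \<open>I\<close>, and the coefficients of the result are class sums
  of \<open>f\<close>, hence zero.
\<close>

lemma congruence_ideal_subset:
  fixes I :: "('m :: comm_monoid_add \<Rightarrow>\<^sub>0 'k :: comm_ring_1) set"
  assumes I: "ideal I ring_of_type_algebra"
    and null: "\<And>u. \<kappa> u = None \<Longrightarrow> Poly_Mapping.single u 1 \<in> I"
    and binomial: "\<And>u v. \<kappa> u \<noteq> None \<Longrightarrow> \<kappa> u = \<kappa> v \<Longrightarrow>
      Poly_Mapping.single u 1 - Poly_Mapping.single v 1 \<in> I"
  shows "congruence_ideal \<kappa> \<subseteq> I"
proof
  fix f :: "'m \<Rightarrow>\<^sub>0 'k"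
  assume f: "f \<in> congruence_ideal \<kappa>"
  define rep where "rep c = (SOME m. \<kappa> m = c)" for c
  have rep: "\<kappa> (rep (\<kappa> m)) = \<kappa> m" for m
    unfolding rep_def by (rule someI_ex) blast
  define r where "r m = (if \<kappa> m = None then 0 else Poly_Mapping.single (rep (\<kappa> m)) (1 :: 'k))" for m
  let ?c = "\<lambda>m. Poly_Mapping.single 0 (Poly_Mapping.lookup f m)"
  have "(\<Sum>m\<in>Poly_Mapping.keys f. ?c m * r m) = 0"
  proof (rule poly_mapping_eqI)
    fix x
    have "Poly_Mapping.lookup (\<Sum>m\<in>Poly_Mapping.keys f. ?c m * r m) x =
        coeff_sum (\<lambda>m. \<kappa> m \<noteq> None \<and> rep (\<kappa> m) = x) f"
      unfolding lookup_sum
      by (subst coeff_sum_superset[of "Poly_Mapping.keys f"])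
        (auto simp: r_def mult_single lookup_single when_def intro!: sum.cong)
    also have "\<dots> = 0" by (rule coeff_sum_union_of_classes[OF f]) auto
    finally show "Poly_Mapping.lookup (\<Sum>m\<in>Poly_Mapping.keys f. ?c m * r m) x =
      Poly_Mapping.lookup 0 x" by simp
  qed
  then have "f = (\<Sum>m\<in>Poly_Mapping.keys f. ?c m * (Poly_Mapping.single m 1 - r m))"
    unfolding right_diff_distrib sum_subtractf by (simp add: mult_single flip: sum_of_monomials)
  moreover have "Poly_Mapping.single m 1 - r m \<in> I" for m
  proof (cases "\<kappa> m")
    case None
    then show ?thesis using null[of m] by (simp add: r_def)
  next
    case (Some c)
    then show ?thesis using binomial[of m "rep (\<kappa> m)"] rep[of m] by (simp add: r_def)
  qed
  then have "(\<Sum>m\<in>Poly_Mapping.keys f. ?c m * (Poly_Mapping.single m 1 - r m)) \<in> I"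
    by (intro ideal_type_algebraD(5)[OF I] ideal_type_algebraD(3)[OF I])
  ultimately show "f \<in> I" by (rule ssubst)
qed

text \<open>
  A set of monomials that is closed under the moves given by a set of binomials does not distinguish
  the monomials that these binomials identify.  The linear functional \<open>coeff_sum P\<close> need not
  vanish on an ideal just because it vanishes on its generators; but the polynomials all of whose
  multiples it annihilates do form an ideal.
\<close>

lemma coeff_sum_ideal_invariant:
  fixes f :: "'m :: comm_monoid_add \<Rightarrow>\<^sub>0 'k :: comm_ring_1"
  assumes inv: "\<And>u v w. (u, v) \<in> B \<Longrightarrow> P (w + u) = P (w + v)"
    and f: "f \<in> Idl\<^bsub>ring_of_type_algebra\<^esub>
      ((\<lambda>(u, v). Poly_Mapping.single u 1 - Poly_Mapping.single v 1) ` B)"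
  shows "coeff_sum P f = 0"
proof -
  let ?K = "{f :: 'm \<Rightarrow>\<^sub>0 'k. \<forall>g. coeff_sum P (g * f) = 0}"
  have "ideal ?K ring_of_type_algebra"
    by (rule ideal_type_algebraI) (auto simp: distrib_left simp flip: mult.assoc)
  moreover
  have "coeff_sum P (g * (Poly_Mapping.single u 1 - Poly_Mapping.single v 1)) = 0"
    if "(u, v) \<in> B" for g :: "'m \<Rightarrow>\<^sub>0 'k" and u v
    by (induction g rule: mpoly_induct)
      (simp_all add: right_diff_distrib distrib_right mult_single inv[OF that])
  then have "(\<lambda>(u, v). Poly_Mapping.single u 1 - Poly_Mapping.single v 1) ` B \<subseteq> ?K" by auto
  ultimately have "Idl\<^bsub>ring_of_type_algebra\<^esub>
      ((\<lambda>(u, v). Poly_Mapping.single u 1 - Poly_Mapping.single v 1) ` B) \<subseteq> ?K"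
    by (rule genideal_type_algebra_minimal)
  with f have "f \<in> ?K" by (rule rev_subsetD)
  then have "coeff_sum P (1 * f) = 0" by blast
  then show ?thesis by simp
qed

section \<open>The ideal of a monomial curve and its tangent cone\<close>

definition weighted_deg :: "('v :: finite \<Rightarrow> nat) \<Rightarrow> ('v \<Rightarrow>\<^sub>0 nat) \<Rightarrow> nat" where
  "weighted_deg n m = (\<Sum>i\<in>UNIV. n i * Poly_Mapping.lookup m i)"

lemma weighted_deg_add [simp]: "weighted_deg n (u + v) = weighted_deg n u + weighted_deg n v"
  by (simp add: weighted_deg_def lookup_add sum.distrib distrib_left)

lemma weighted_deg_single [simp]: "weighted_deg n (Poly_Mapping.single i k) = n i * k"
  by (simp add: weighted_deg_def lookup_single when_def if_distrib[of "(*) _"] cong: if_cong)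

lemma mono_deg_add [simp]: "mono_deg (u + v) = mono_deg u + mono_deg v"
  by (simp add: mono_deg_def lookup_add sum.distrib)

lemma mono_deg_single [simp]: "mono_deg (Poly_Mapping.single i k) = k"
  by (simp add: mono_deg_def lookup_single when_def)

lemma coeff_curve_hom:
  fixes f :: "('v :: finite, 'k :: comm_ring_1) mpoly"
  shows "Polynomial.coeff (curve_hom n f) s = coeff_sum (\<lambda>m. weighted_deg n m = s) f"
proof -
  have "(\<Prod>i\<in>UNIV. Polynomial.monom (1 :: 'k) (n i) ^ Poly_Mapping.lookup m i) =
      Polynomial.monom 1 (weighted_deg n m)" for m
  proof -
    have "(\<Prod>i\<in>A. Polynomial.monom (1 :: 'k) (n i) ^ Poly_Mapping.lookup m i) =
        Polynomial.monom 1 (\<Sum>i\<in>A. n i * Poly_Mapping.lookup m i)" for A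
      by (induction A rule: infinite_finite_induct) (auto simp: monom_power mult_monom)
    then show ?thesis by (simp add: weighted_deg_def)
  qed
  then show ?thesis
    unfolding curve_hom_def
    by (subst coeff_sum_superset[of "Poly_Mapping.keys f"])
      (auto simp: Polynomial.coeff_sum intro!: sum.cong)
qed

lemma curve_ideal_eq: "curve_ideal n = congruence_ideal (\<lambda>m. Some (weighted_deg n m))"
  by (auto simp: curve_ideal_def congruence_ideal_def poly_eq_iff coeff_curve_hom)

text \<open>
  The initial form of a difference of two monomials of the same weight and different degrees is the
  monomial of lower degree.  So only the following monomials survive in the tangent cone, and those
  of the same weight are identified there.
\<close>

definition top_monomial :: "('v :: finite \<Rightarrow> nat) \<Rightarrow> ('v \<Rightarrow>\<^sub>0 nat) \<Rightarrow> bool" where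
  "top_monomial n m \<longleftrightarrow> (\<forall>m'. weighted_deg n m' = weighted_deg n m \<longrightarrow> mono_deg m' \<le> mono_deg m)"

definition cone_class :: "('v :: finite \<Rightarrow> nat) \<Rightarrow> ('v \<Rightarrow>\<^sub>0 nat) \<Rightarrow> nat option" where
  "cone_class n m = (if top_monomial n m then Some (weighted_deg n m) else None)"

lemma top_monomial_divisor: "top_monomial n (w + u) \<Longrightarrow> top_monomial n u"
  unfolding top_monomial_def
proof (intro allI impI)
  fix m'
  assume "\<forall>m'. weighted_deg n m' = weighted_deg n (w + u) \<longrightarrow> mono_deg m' \<le> mono_deg (w + u)"
    and "weighted_deg n m' = weighted_deg n u"
  then have "mono_deg (w + m') \<le> mono_deg (w + u)" by (metis weighted_deg_add)
  then show "mono_deg m' \<le> mono_deg u" by simp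
qed

lemma top_monomial_same_degree:
  "top_monomial n u \<Longrightarrow> top_monomial n v \<Longrightarrow> weighted_deg n u = weighted_deg n v \<Longrightarrow>
    mono_deg u = mono_deg v"
  unfolding top_monomial_def by (metis le_antisym)

lemma monomial_congruence_cone_class: "monomial_congruence (cone_class n)"
proof -
  have "cone_class n (w + u) = cone_class n (w + v)" if eq: "cone_class n u = cone_class n v" for u v w
  proof (cases "top_monomial n u")
    case True
    then have "top_monomial n v" "weighted_deg n u = weighted_deg n v"
      using eq by (auto simp: cone_class_def split: if_splits)
    moreover from this have "mono_deg u = mono_deg v" using True top_monomial_same_degree by blast
    ultimately have "top_monomial n (w + u) \<longleftrightarrow> top_monomial n (w + v)"
      by (simp add: top_monomial_def)
    then show ?thesis using \<open>weighted_deg n u = weighted_deg n v\<close> by (simp add: cone_class_def)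
  next
    case False
    then have "\<not> top_monomial n v" using eq by (auto simp: cone_class_def split: if_splits)
    then show ?thesis using False top_monomial_divisor by (auto simp: cone_class_def)
  qed
  moreover have "cone_class n (w + u) = None" if "cone_class n u = None" for u w
    using that top_monomial_divisor by (auto simp: cone_class_def split: if_splits)
  ultimately show ?thesis unfolding monomial_congruence_def by blast
qed

lemma lookup_hom_component:
  "Poly_Mapping.lookup (hom_component d f) m = (if mono_deg m = d then Poly_Mapping.lookup f m else 0)"
  by (simp add: hom_component_def lookup_sum lookup_single when_def in_keys_iff)

lemma keys_hom_component:
  "Poly_Mapping.keys (hom_component d f) = {m \<in> Poly_Mapping.keys f. mono_deg m = d}"
  by (auto simp: in_keys_iff lookup_hom_component split: if_splits)

text \<open>
  For \<open>f\<close> in the curve ideal with initial degree \<open>d\<close>, consider the monomials of \<open>f\<close> of weight \<open>s\<close>.  If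
  the largest degree in the fibre of \<open>s\<close> is \<open>d\<close>, then all of them have degree \<open>d\<close>, and their
  coefficients sum to zero; otherwise none of those in the initial form survives.  Conversely,
  the differences and monomials that generate the right-hand side are initial forms of
  binomials.
\<close>

theorem initial_ideal_curve_ideal:
  "initial_ideal (curve_ideal n :: ('v :: finite, 'k :: comm_ring_1) mpoly set) =
    congruence_ideal (cone_class n)"
proof
  show "initial_ideal (curve_ideal n :: ('v, 'k) mpoly set) \<subseteq> congruence_ideal (cone_class n)"
    unfolding initial_ideal_def
  proof (rule genideal_type_algebra_minimal[OF
        ideal_congruence_ideal[OF monomial_congruence_cone_class]], safe)
    fix f :: "('v, 'k) mpoly"
    assume f: "f \<in> curve_ideal n"
    define d where "d = Min (mono_deg ` Poly_Mapping.keys f)"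
    have d: "d \<le> mono_deg m" if "m \<in> Poly_Mapping.keys f" for m
      unfolding d_def using that by simp
    have init: "initial_form f = hom_component d f" by (simp add: initial_form_def d_def)
    have "coeff_sum (\<lambda>m. cone_class n m = Some s) (initial_form f) = 0" for s
    proof (cases "\<exists>m. top_monomial n m \<and> weighted_deg n m = s \<and> mono_deg m = d")
      case True
      then obtain m\<^sub>0 where m\<^sub>0: "top_monomial n m\<^sub>0" "weighted_deg n m\<^sub>0 = s" "mono_deg m\<^sub>0 = d"
        by blast
      have *: "mono_deg m = d \<and> top_monomial n m"
        if "m \<in> Poly_Mapping.keys f" "weighted_deg n m = s" for m
      proof -
        have "mono_deg m = d"
          using d[OF that(1)] that(2) m\<^sub>0 unfolding top_monomial_def by (metis le_antisym)
        then show ?thesis using that(2) m\<^sub>0 by (simp add: top_monomial_def)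
      qed
      have "coeff_sum (\<lambda>m. cone_class n m = Some s) (initial_form f) =
          coeff_sum (\<lambda>m. weighted_deg n m = s) f"
        unfolding coeff_sum_def init
        by (rule sum.cong)
          (use * in \<open>auto simp: keys_hom_component lookup_hom_component cone_class_def split: if_splits\<close>)
      then show ?thesis using f by (simp add: curve_ideal_eq congruence_ideal_def)
    next
      case False
      then have "{m \<in> Poly_Mapping.keys (initial_form f). cone_class n m = Some s} = {}"
        by (auto simp: init keys_hom_component cone_class_def split: if_splits)
      then show ?thesis unfolding coeff_sum_def by (simp only: sum.empty)
    qed
    then show "initial_form f \<in> congruence_ideal (cone_class n)"
      by (simp add: congruence_ideal_def)
  qed
next
  have init: "initial_form f \<in> initial_ideal (curve_ideal n)" if "f \<in> curve_ideal n"
    for f :: "('v, 'k) mpoly"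
    unfolding initial_ideal_def using genideal_type_algebra(2) that by blast
  have binomial: "Poly_Mapping.single u 1 - Poly_Mapping.single v 1 \<in> (curve_ideal n :: ('v, 'k) mpoly set)"
    if "weighted_deg n u = weighted_deg n v" for u v
    using that by (simp add: curve_ideal_eq binomial_mem_congruence_ideal)
  have keys: "Poly_Mapping.keys (Poly_Mapping.single u (1 :: 'k) - Poly_Mapping.single v 1) = {u, v}"
    if "u \<noteq> v" for u v :: "'v \<Rightarrow>\<^sub>0 nat"
    using that by (auto simp: in_keys_iff lookup_minus lookup_single when_def split: if_splits)
  show "congruence_ideal (cone_class n) \<subseteq> initial_ideal (curve_ideal n :: ('v, 'k) mpoly set)"
  proof (rule congruence_ideal_subset)
    show "ideal (initial_ideal (curve_ideal n :: ('v, 'k) mpoly set)) ring_of_type_algebra"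
      unfolding initial_ideal_def by (rule genideal_type_algebra)
  next
    fix u
    assume "cone_class n u = None"
    then obtain v where v: "weighted_deg n v = weighted_deg n u" "mono_deg u < mono_deg v"
      by (auto simp: cone_class_def top_monomial_def not_le split: if_splits)
    let ?f = "Poly_Mapping.single u (1 :: 'k) - Poly_Mapping.single v 1"
    have "u \<noteq> v" using v by auto
    then have "initial_form ?f = hom_component (mono_deg u) ?f"
      using v by (simp add: initial_form_def keys)
    also have "\<dots> = Poly_Mapping.single u 1"
      by (rule poly_mapping_eqI)
        (use v in \<open>auto simp: lookup_hom_component lookup_minus lookup_single when_def\<close>)
    finally show "Poly_Mapping.single u 1 \<in> initial_ideal (curve_ideal n :: ('v, 'k) mpoly set)"
      using init[OF binomial[of u v]] v by simp
  next
    fix u v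
    assume "cone_class n u \<noteq> None" "cone_class n u = cone_class n v"
    then have uv: "top_monomial n u" "top_monomial n v" "weighted_deg n u = weighted_deg n v"
      by (auto simp: cone_class_def split: if_splits)
    from top_monomial_same_degree[OF this] have deg: "mono_deg u = mono_deg v" .
    let ?f = "Poly_Mapping.single u (1 :: 'k) - Poly_Mapping.single v 1"
    have "initial_form ?f = ?f"
    proof (cases "u = v")
      case False
      have "initial_form ?f = hom_component (mono_deg u) ?f"
        using deg by (simp add: initial_form_def keys[OF False])
      also have "\<dots> = ?f"
        by (rule poly_mapping_eqI)
          (use deg in \<open>auto simp: lookup_hom_component lookup_minus lookup_single when_def\<close>)
      finally show ?thesis .
    qed (simp add: initial_form_def hom_component_def)
    then show "?f \<in> initial_ideal (curve_ideal n)"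
      using init[OF binomial[OF uv(3)]] by simp
  qed
qed

section \<open>Thickenings of the affine line\<close>

lemma polynomial_ideal_generator:
  fixes I :: "'k :: field poly set"
  assumes add: "\<And>f g. f \<in> I \<Longrightarrow> g \<in> I \<Longrightarrow> f + g \<in> I"
    and mult: "\<And>f g. f \<in> I \<Longrightarrow> g * f \<in> I" and "0 \<in> I"
  shows "\<exists>p\<in>I. \<forall>f\<in>I. p dvd f"
proof (cases "I \<subseteq> {0}")
  case True
  then show ?thesis using \<open>0 \<in> I\<close> by auto
next
  case False
  then have "\<exists>p. p \<in> I \<and> p \<noteq> 0" by auto
  then obtain p where p: "p \<in> I \<and> p \<noteq> 0" "\<And>f. f \<in> I \<and> f \<noteq> 0 \<Longrightarrow> degree p \<le> degree f"
    using ex_has_least_nat[of "\<lambda>p. p \<in> I \<and> p \<noteq> 0" _ degree] by blast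
  have "p dvd f" if "f \<in> I" for f
  proof (rule ccontr)
    assume "\<not> p dvd f"
    then have nz: "f mod p \<noteq> 0" by (simp add: dvd_eq_mod_eq_0)
    have "f mod p = f + (- (f div p)) * p"
      using minus_div_mult_eq_mod[of f p] by simp
    then have "f mod p \<in> I" using that p(1) add mult by metis
    then have "degree p \<le> degree (f mod p)" using p(2) nz by blast
    moreover have "degree (f mod p) < degree p" using degree_mod_less[of p f] p(1) nz by auto
    ultimately show False by simp
  qed
  then show ?thesis using p(1) by blast
qed

context cring
begin

definition nonzerodivisor :: "'a \<Rightarrow> bool" where
  "nonzerodivisor y \<longleftrightarrow> (\<forall>z\<in>carrier R. y \<otimes> z = \<zero> \<longrightarrow> z = \<zero>)"

lemma genideal_empty: "Idl {} = {\<zero>}"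
proof
  show "Idl {} \<subseteq> {\<zero>}" by (rule genideal_minimal) (auto intro: zeroideal)
  have "ideal (Idl {}) R" by (rule genideal_ideal) simp
  then show "{\<zero>} \<subseteq> Idl {}"
    using additive_subgroup.zero_closed[OF ideal.axioms(1)] by simp
qed

lemma power_congruent:
  assumes I: "ideal I R" and x: "x \<in> carrier R" and y: "y \<in> carrier R" and xy: "x \<ominus> y \<in> I"
  shows "x [^] (k :: nat) \<ominus> y [^] k \<in> I"
proof (induction k)
  case 0
  then show ?case
    using additive_subgroup.zero_closed[OF ideal.axioms(1)[OF I]] by (simp add: r_neg minus_eq)
next
  case (Suc k)
  interpret I: ideal I R by fact
  have c: "x [^] k \<in> carrier R" "y [^] k \<in> carrier R" using x y by simp_all
  have "x [^] Suc k \<ominus> y [^] Suc k = x [^] k \<otimes> (x \<ominus> y) \<oplus> (x [^] k \<ominus> y [^] k) \<otimes> y"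
    unfolding nat_pow_Suc using x y c by algebra
  moreover have "x [^] k \<otimes> (x \<ominus> y) \<in> I" by (rule I.I_l_closed[OF xy c(1)])
  moreover have "(x [^] k \<ominus> y [^] k) \<otimes> y \<in> I" by (rule I.I_r_closed[OF Suc.IH y])
  ultimately show ?case using additive_subgroup.a_closed[OF ideal.axioms(1)[OF I]] by simp
qed

lemma prime_power_mem:
  assumes "primeideal P R" "a \<in> carrier R" "a [^] (k :: nat) \<in> P"
  shows "a \<in> P"
  using assms(3)
proof (induction k)
  case 0
  then have "\<one> \<in> P" by simp
  then show ?case
    using ideal.one_imp_carrier[OF primeideal.axioms(1)[OF assms(1)]] primeideal.I_notcarr[OF assms(1)]
    by simp
next
  case (Suc k)
  then show ?case using primeideal.I_prime[OF assms(1), of "a [^] k" a] assms(2) by auto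
qed

lemma cancel_power:
  assumes y: "y \<in> carrier R"
    and reg: "\<And>z. z \<in> carrier R \<Longrightarrow> y \<otimes> z \<in> I \<Longrightarrow> z \<in> I"
  shows "z \<in> carrier R \<Longrightarrow> y [^] (k :: nat) \<otimes> z \<in> I \<Longrightarrow> z \<in> I"
proof (induction k)
  case (Suc k)
  have "y [^] Suc k \<otimes> z = y \<otimes> (y [^] k \<otimes> z)"
    using y Suc.prems(1) by (simp add: m_ac)
  then show ?case using Suc reg y by (metis m_closed nat_pow_closed)
qed simp

lemma annihilator_ideal:
  assumes z: "z \<in> carrier R"
  shows "ideal {a \<in> carrier R. a \<otimes> z = \<zero>} R"
proof (rule idealI[OF ring_axioms])
  show "subgroup {a \<in> carrier R. a \<otimes> z = \<zero>} (add_monoid R)"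
  proof (rule add.subgroupI)
    fix a assume "a \<in> {a \<in> carrier R. a \<otimes> z = \<zero>}"
    then show "\<ominus> a \<in> {a \<in> carrier R. a \<otimes> z = \<zero>}" using z by (simp add: l_minus)
  qed (use z in \<open>auto simp: l_distr\<close>)
next
  fix a x
  assume a: "a \<in> {a \<in> carrier R. a \<otimes> z = \<zero>}" and x: "x \<in> carrier R"
  then have "x \<otimes> a \<otimes> z = \<zero>" using z by (simp add: m_assoc)
  then show "x \<otimes> a \<in> {a \<in> carrier R. a \<otimes> z = \<zero>}" "a \<otimes> x \<in> {a \<in> carrier R. a \<otimes> z = \<zero>}"
    using a x z by (auto simp: m_comm)
qed

end

text \<open>
  A ring with reduction \<open>K[x]\<close>: \<open>eps\<close> is the projection to the reduction, whose kernel is nil, and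
  \<open>theta\<close> is a section of it, which turns the ring into a \<open>K[x]\<close>-algebra.
\<close>

locale thickened_line = cring A for A (structure) +
  fixes eps :: "'a \<Rightarrow> 'k :: field poly" and theta :: "'k poly \<Rightarrow> 'a"
  assumes eps_hom: "eps \<in> ring_hom A ring_of_type_algebra"
    and theta_hom: "theta \<in> ring_hom ring_of_type_algebra A"
    and eps_theta [simp]: "eps (theta p) = p"
    and nilpotent: "a \<in> carrier A \<Longrightarrow> eps a = 0 \<Longrightarrow> \<exists>e :: nat. a [^] e = \<zero>"
begin

lemma theta_closed [simp]: "theta p \<in> carrier A"
  using ring_hom_closed[OF theta_hom] by simp

lemma theta_simps:
  "theta (p * q) = theta p \<otimes> theta q" "theta (p + q) = theta p \<oplus> theta q" "theta 1 = \<one>"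
  using ring_hom_mult[OF theta_hom, of p q] ring_hom_add[OF theta_hom, of p q]
    ring_hom_one[OF theta_hom] by simp_all

lemma eps_simps [simp]:
  "a \<in> carrier A \<Longrightarrow> b \<in> carrier A \<Longrightarrow> eps (a \<otimes> b) = eps a * eps b"
  "a \<in> carrier A \<Longrightarrow> b \<in> carrier A \<Longrightarrow> eps (a \<oplus> b) = eps a + eps b"
  "eps \<one> = 1"
  using ring_hom_mult[OF eps_hom, of a b] ring_hom_add[OF eps_hom, of a b]
    ring_hom_one[OF eps_hom] by simp_all

lemma eps_zero [simp]: "eps \<zero> = 0"
proof -
  have "eps \<zero> + eps \<zero> = eps \<zero> + 0" using eps_simps(2)[of \<zero> \<zero>] by simp
  then show ?thesis by (simp only: add_left_cancel)
qed

lemma eps_neg [simp]: "a \<in> carrier A \<Longrightarrow> eps (\<ominus> a) = - eps a"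
  using eps_simps(2)[of a "\<ominus> a"] by (simp add: r_neg eq_neg_iff_add_eq_0 add.commute)

lemma eps_diff [simp]: "a \<in> carrier A \<Longrightarrow> b \<in> carrier A \<Longrightarrow> eps (a \<ominus> b) = eps a - eps b"
  by (simp add: minus_eq)

lemma eps_power [simp]: "a \<in> carrier A \<Longrightarrow> eps (a [^] (k :: nat)) = eps a ^ k"
  by (induction k) (simp_all add: mult.commute)

lemma theta_zero: "theta 0 = \<zero>"
proof -
  have "theta 0 = theta 0 \<oplus> theta 0" using theta_simps(2)[of 0 0] by simp
  then show ?thesis by (metis add.l_cancel_one' theta_closed)
qed

text \<open>
  Whether some power of an element lies in an ideal depends only on its image in the reduction:
  \<open>b ^ e - c ^ e\<close> is nilpotent, and \<open>b ^ e\<close> is congruent to it modulo \<open>I\<close>.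
\<close>

lemma nil_congruent_power:
  assumes I: "ideal I A" and b: "b \<in> carrier A" and c: "c \<in> carrier A"
    and eq: "eps b = eps c" and mem: "c [^] (e :: nat) \<in> I"
  shows "\<exists>k :: nat. b [^] k \<in> I"
proof -
  interpret I: ideal I A by fact
  let ?x = "b [^] e" and ?y = "b [^] e \<ominus> c [^] e"
  have car: "?x \<in> carrier A" "?y \<in> carrier A" "c [^] e \<in> carrier A" using b c by simp_all
  obtain f :: nat where f: "?y [^] f = \<zero>"
    using nilpotent[of ?y] car b c eq by auto
  have "?x \<ominus> ?y = c [^] e" using car(1,3) by algebra
  then have "?x [^] f \<ominus> ?y [^] f \<in> I" using power_congruent[OF I car(1,2)] mem by simp
  then have "b [^] (e * f) \<in> I" using f b by (simp add: nat_pow_pow minus_eq)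
  then show ?thesis by blast
qed

definition dvd_ideal :: "'k poly \<Rightarrow> 'a set" where
  "dvd_ideal q = {a \<in> carrier A. q dvd eps a}"

lemma ideal_dvd_ideal: "ideal (dvd_ideal q) A"
proof (rule idealI[OF ring_axioms])
  show "subgroup (dvd_ideal q) (add_monoid A)"
  proof (rule add.subgroupI)
    show "dvd_ideal q \<noteq> {}" using zero_closed by (auto simp: dvd_ideal_def)
  qed (auto simp: dvd_ideal_def)
qed (auto simp: dvd_ideal_def)

text \<open>
  A prime contains the nil kernel of \<open>eps\<close>, so it is the preimage of its image, which is a
  principal ideal of \<open>K[x]\<close>.
\<close>

lemma prime_generator:
  assumes P: "primeideal P A"
  obtains p where "P = dvd_ideal p" "\<not> p dvd 1"
proof -
  interpret P: primeideal P A by fact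
  note closed = additive_subgroup.zero_closed[OF ideal.axioms(1)[OF P.is_ideal]]
    additive_subgroup.a_closed[OF ideal.axioms(1)[OF P.is_ideal]]
  have kernel: "a \<in> P" if ab: "a \<in> carrier A" "b \<in> P" "eps a = eps b" for a b
  proof -
    have b: "b \<in> carrier A" using ab(2) P.Icarr by simp
    obtain e :: nat where "(a \<ominus> b) [^] e = \<zero>" using nilpotent[of "a \<ominus> b"] ab b by auto
    then have "a \<ominus> b \<in> P" using prime_power_mem[OF P, of "a \<ominus> b" e] ab b closed(1) by simp
    then have "(a \<ominus> b) \<oplus> b \<in> P" using ab(2) closed(2) by simp
    moreover have "(a \<ominus> b) \<oplus> b = a" using ab(1) b by algebra
    ultimately show ?thesis by simp
  qed
  have "\<exists>p\<in>eps ` P. \<forall>f\<in>eps ` P. p dvd f"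
  proof (rule polynomial_ideal_generator)
    fix f g
    assume f: "f \<in> eps ` P"
    then obtain a where a: "a \<in> P" "f = eps a" by blast
    have "theta g \<otimes> a \<in> P" using a P.I_l_closed by simp
    moreover have "g * f = eps (theta g \<otimes> a)" using a P.Icarr by simp
    ultimately show "g * f \<in> eps ` P" by blast
    assume "g \<in> eps ` P"
    then obtain b where b: "b \<in> P" "g = eps b" by blast
    have "a \<oplus> b \<in> P" using a b closed by simp
    moreover have "f + g = eps (a \<oplus> b)" using a b P.Icarr by simp
    ultimately show "f + g \<in> eps ` P" by blast
  next
    show "0 \<in> eps ` P" by (rule image_eqI[where x = "\<zero>"]) (simp_all add: closed)
  qed
  then obtain a where a: "a \<in> P" "\<And>b. b \<in> P \<Longrightarrow> eps a dvd eps b" by blast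
  have mem: "b \<in> P" if b: "b \<in> carrier A" "eps a dvd eps b" for b
  proof -
    from b(2) obtain h where h: "eps b = eps a * h" by (rule dvdE)
    have "a \<otimes> theta h \<in> P" using a(1) P.I_r_closed by simp
    then show ?thesis using kernel[OF b(1)] h a(1) P.Icarr by simp
  qed
  have "P = dvd_ideal (eps a)"
  proof (intro equalityI subsetI)
    show "b \<in> dvd_ideal (eps a)" if "b \<in> P" for b
      using that a(2) P.Icarr by (simp add: dvd_ideal_def)
    show "b \<in> P" if "b \<in> dvd_ideal (eps a)" for b
      using that mem by (simp add: dvd_ideal_def)
  qed
  moreover have "\<not> eps a dvd 1"
  proof
    assume "eps a dvd 1"
    then have "\<one> \<in> P" using mem[of \<one>] by simp
    from P.one_imp_carrier[OF this] show False using P.I_notcarr by simp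
  qed
  ultimately show ?thesis by (rule that)
qed

lemma primeideal_kernel: "primeideal (dvd_ideal 0) A"
proof (rule primeidealI[OF ideal_dvd_ideal is_cring])
  have "\<one> \<notin> dvd_ideal 0" by (simp add: dvd_ideal_def)
  then show "carrier A \<noteq> dvd_ideal 0" using one_closed by blast
next
  fix a b
  assume "a \<in> carrier A" "b \<in> carrier A" "a \<otimes> b \<in> dvd_ideal 0"
  then show "a \<in> dvd_ideal 0 \<or> b \<in> dvd_ideal 0" by (simp add: dvd_ideal_def)
qed

lemma maximalideal_origin: "maximalideal (dvd_ideal [:0, 1:]) A"
proof (rule maximalidealI[OF ideal_dvd_ideal])
  have dvd: "[:0, 1:] dvd f \<longleftrightarrow> Polynomial.coeff f 0 = 0" for f :: "'k poly"
    using dvd_iff_poly_eq_0[of 0 f] by (simp add: poly_0_coeff_0)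
  have "\<one> \<notin> dvd_ideal [:0, 1:]" by (simp add: dvd_ideal_def dvd)
  then show "carrier A \<noteq> dvd_ideal [:0, 1:]" using one_closed by blast
  fix J
  assume J: "ideal J A" "dvd_ideal [:0, 1:] \<subseteq> J"
  interpret J: ideal J A by fact
  show "J = dvd_ideal [:0, 1:] \<or> J = carrier A"
  proof (rule disjCI)
    assume "J \<noteq> carrier A"
    have "z \<in> dvd_ideal [:0, 1:]" if z: "z \<in> J" for z
    proof (rule ccontr)
      assume "z \<notin> dvd_ideal [:0, 1:]"
      moreover have zc: "z \<in> carrier A" using z J.Icarr by simp
      ultimately have c: "Polynomial.coeff (eps z) 0 \<noteq> 0" by (simp add: dvd_ideal_def dvd)
      let ?u = "theta [:inverse (Polynomial.coeff (eps z) 0):] \<otimes> z"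
      have u: "?u \<in> J" "?u \<in> carrier A" using J.I_l_closed z zc by simp_all
      have "\<one> \<ominus> ?u \<in> J"
      proof (rule subsetD[OF J(2)])
        show "\<one> \<ominus> ?u \<in> dvd_ideal [:0, 1:]" using zc c by (simp add: dvd_ideal_def dvd)
      qed
      then have "(\<one> \<ominus> ?u) \<oplus> ?u \<in> J"
        using u additive_subgroup.a_closed[OF ideal.axioms(1)[OF J(1)]] by simp
      moreover have "(\<one> \<ominus> ?u) \<oplus> ?u = \<one>" using u(2) by algebra
      ultimately have "\<one> \<in> J" by simp
      from J.one_imp_carrier[OF this] show False using \<open>J \<noteq> carrier A\<close> by simp
    qed
    then show "J = dvd_ideal [:0, 1:]" using J(2) by blast
  qed
qed

lemma maximal_generator:
  assumes P: "maximalideal P A"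
  obtains p where "P = dvd_ideal p" "\<not> p dvd 1" "p \<noteq> 0"
proof -
  obtain p where p: "P = dvd_ideal p" "\<not> p dvd 1"
    using prime_generator maximalideal_prime[OF P] by blast
  have "p \<noteq> 0"
  proof
    assume "p = 0"
    then have "P \<subseteq> dvd_ideal [:0, 1:]" using p by (auto simp: dvd_ideal_def)
    then have "dvd_ideal [:0, 1:] = P \<or> dvd_ideal [:0, 1:] = carrier A"
      using maximalideal.I_maximal[OF P ideal_dvd_ideal] by (auto simp: dvd_ideal_def)
    moreover have "dvd_ideal [:0, 1:] \<noteq> carrier A"
      using maximalideal.I_notcarr[OF maximalideal_origin] by simp
    moreover have "theta [:0, 1:] \<in> dvd_ideal [:0, 1:]" "theta [:0, 1:] \<notin> P"
      using p \<open>p = 0\<close> by (auto simp: dvd_ideal_def)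
    ultimately show False by blast
  qed
  then show ?thesis using p that by blast
qed

text \<open>
  Via the reduction this says that nonzero primes of \<open>K[x]\<close> are maximal.
\<close>

lemma no_long_prime_chain:
  assumes Q: "primeideal Q\<^sub>0 A" "primeideal Q\<^sub>1 A" "primeideal Q\<^sub>2 A" "Q\<^sub>0 \<subset> Q\<^sub>1" "Q\<^sub>1 \<subset> Q\<^sub>2"
  shows False
proof -
  obtain p\<^sub>0 where p\<^sub>0: "Q\<^sub>0 = dvd_ideal p\<^sub>0" using prime_generator[OF Q(1)] by blast
  obtain p\<^sub>1 where p\<^sub>1: "Q\<^sub>1 = dvd_ideal p\<^sub>1" "\<not> p\<^sub>1 dvd 1" using prime_generator[OF Q(2)] by blast
  obtain p\<^sub>2 where p\<^sub>2: "Q\<^sub>2 = dvd_ideal p\<^sub>2" "\<not> p\<^sub>2 dvd 1" using prime_generator[OF Q(3)] by blast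
  have "p\<^sub>1 \<noteq> 0" using Q(4) p\<^sub>0 p\<^sub>1 by (auto simp: dvd_ideal_def)
  have "theta p\<^sub>1 \<in> Q\<^sub>2" using Q(5) p\<^sub>1 by (auto simp: dvd_ideal_def)
  then obtain h where h: "p\<^sub>1 = p\<^sub>2 * h" using p\<^sub>2 by (auto simp: dvd_ideal_def)
  have "theta p\<^sub>2 \<otimes> theta h \<in> Q\<^sub>1" using p\<^sub>1 h by (simp add: dvd_ideal_def)
  then have "theta p\<^sub>2 \<in> Q\<^sub>1 \<or> theta h \<in> Q\<^sub>1" using primeideal.I_prime[OF Q(2)] by simp
  then show False
  proof
    assume "theta p\<^sub>2 \<in> Q\<^sub>1"
    then have "p\<^sub>1 dvd p\<^sub>2" using p\<^sub>1 by (simp add: dvd_ideal_def)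
    then have "Q\<^sub>2 \<subseteq> Q\<^sub>1" using p\<^sub>1 p\<^sub>2 by (auto simp: dvd_ideal_def)
    then show False using Q(5) by blast
  next
    assume "theta h \<in> Q\<^sub>1"
    then obtain k where k: "h = p\<^sub>1 * k" using p\<^sub>1 by (auto simp: dvd_ideal_def)
    have "p\<^sub>1 * (p\<^sub>2 * k) = p\<^sub>2 * h" unfolding k by (rule mult.left_commute)
    also have "\<dots> = p\<^sub>1 * 1" using h by simp
    finally have "p\<^sub>1 * (p\<^sub>2 * k) = p\<^sub>1 * 1" .
    then have "1 = p\<^sub>2 * k" using \<open>p\<^sub>1 \<noteq> 0\<close> by simp
    then have "p\<^sub>2 dvd 1" by (rule dvdI)
    then show False using p\<^sub>2(2) by contradiction
  qed
qed

lemma prime_codim_maximal: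
  assumes P: "maximalideal P A"
  shows "prime_codim A P = 1"
proof (rule antisym)
  obtain p where p: "P = dvd_ideal p" "p \<noteq> 0" using maximal_generator[OF P] by blast
  have prime: "primeideal P A" using maximalideal_prime[OF P] .
  show "prime_codim A P \<le> 1"
    unfolding prime_codim_def
  proof (rule Sup_least, safe)
    fix r Q
    assume Q: "\<forall>i\<le>r. primeideal (Q i) A" "\<forall>i<r. Q i \<subset> Q (Suc i)"
    show "enat r \<le> 1"
    proof (rule ccontr)
      assume "\<not> enat r \<le> 1"
      then have "2 \<le> r" by (simp add: one_enat_def)
      then obtain s where s: "r = Suc (Suc s)" by (metis add_2_eq_Suc le_Suc_ex)
      show False
        by (rule no_long_prime_chain[of "Q s" "Q (Suc s)" "Q (Suc (Suc s))"]) (use Q s in auto)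
    qed
  qed
  define Q where "Q i = (if i = 0 then dvd_ideal 0 else P)" for i :: nat
  have "dvd_ideal 0 \<subset> P"
  proof
    show "dvd_ideal 0 \<subseteq> P" using p by (auto simp: dvd_ideal_def)
    have "theta p \<in> P" "theta p \<notin> dvd_ideal 0" using p by (auto simp: dvd_ideal_def)
    then show "dvd_ideal 0 \<noteq> P" by blast
  qed
  then have "(\<forall>i\<le>1. primeideal (Q i) A) \<and> (\<forall>i<1. Q i \<subset> Q (Suc i)) \<and> Q 1 = P"
    using primeideal_kernel prime by (simp add: Q_def)
  then have "enat 1 \<le> prime_codim A P"
    unfolding prime_codim_def by (intro Sup_upper) blast
  then show "1 \<le> prime_codim A P" by (simp add: one_enat_def)
qed

lemma regular_sequence_cancel:
  "regular_sequence A xs \<Longrightarrow> i < length xs \<Longrightarrow> z \<in> carrier A \<Longrightarrow>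
    xs ! i \<otimes> z \<in> Idl (set (take i xs)) \<Longrightarrow> z \<in> Idl (set (take i xs))"
  unfolding regular_sequence_def by blast

text \<open>
  Suppose that \<open>y\<^sub>1, y\<^sub>2\<close> begins a regular sequence in the prime \<open>P\<close>, the preimage of the ideal
  \<open>(p)\<close>, and let \<open>q\<close> be a nonzero polynomial of least degree whose preimages have a power in the ideal
  of \<open>y\<^sub>1\<close>.  Then \<open>q = p \<cdot> q'\<close>, and \<open>eps y\<^sub>2 \<cdot> q'\<close> is a multiple of \<open>q\<close> because \<open>p\<close> divides \<open>eps y\<^sub>2\<close>.
  So a power of \<open>y\<^sub>2 \<cdot> theta q'\<close> lies in the ideal of \<open>y\<^sub>1\<close>; cancelling \<open>y\<^sub>2\<close> shows that \<open>q'\<close>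
  is as good as \<open>q\<close>, although its degree is smaller.
\<close>

lemma regular_sequence_length:
  assumes P: "primeideal P A" and reg: "regular_sequence A xs" and xs: "set xs \<subseteq> P"
  shows "length xs \<le> 1"
proof (rule ccontr)
  assume "\<not> length xs \<le> 1"
  then obtain y\<^sub>1 y\<^sub>2 zs where xs_eq: "xs = y\<^sub>1 # y\<^sub>2 # zs"
    by (cases xs; cases "tl xs") auto
  interpret P: primeideal P A by fact
  have y: "y\<^sub>1 \<in> P" "y\<^sub>2 \<in> P" "y\<^sub>1 \<in> carrier A" "y\<^sub>2 \<in> carrier A"
    using xs P.Icarr by (auto simp: xs_eq)
  define I where "I = Idl {y\<^sub>1}"
  have I: "ideal I A" unfolding I_def by (rule genideal_ideal) (use y in simp)
  interpret I: ideal I A by fact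
  have y\<^sub>1_I: "y\<^sub>1 \<in> I" unfolding I_def using genideal_self'[of y\<^sub>1] y by simp
  have I_P: "I \<subseteq> P" unfolding I_def using genideal_minimal[OF P.is_ideal] y by simp
  have reg1: "z = \<zero>" if "z \<in> carrier A" "y\<^sub>1 \<otimes> z = \<zero>" for z
    using regular_sequence_cancel[OF reg, of 0 z] that by (simp add: xs_eq genideal_empty)
  have reg2: "z \<in> I" if "z \<in> carrier A" "y\<^sub>2 \<otimes> z \<in> I" for z
    using regular_sequence_cancel[OF reg, of 1 z] that by (simp add: xs_eq I_def)
  define S where "S q \<longleftrightarrow> q \<noteq> 0 \<and> (\<exists>a\<in>carrier A. eps a = q \<and> (\<exists>e :: nat. a [^] e \<in> I))" for q
  \<comment> \<open>a nilpotent element is a zero divisor\<close>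
  have "eps y\<^sub>1 \<noteq> 0"
  proof
    assume "eps y\<^sub>1 = 0"
    then obtain e :: nat where e: "y\<^sub>1 [^] e = \<zero>" using nilpotent[OF y(3)] by blast
    have "\<one> \<in> {\<zero>}"
    proof (rule cancel_power[OF y(3)])
      show "z \<in> {\<zero>}" if "z \<in> carrier A" "y\<^sub>1 \<otimes> z \<in> {\<zero>}" for z using reg1 that by simp
      show "y\<^sub>1 [^] e \<otimes> \<one> \<in> {\<zero>}" using e by simp
    qed simp
    then have "eps \<one> = 0" by simp
    then show False by simp
  qed
  moreover have "y\<^sub>1 [^] (1 :: nat) \<in> I" using y\<^sub>1_I y by simp
  ultimately have "S (eps y\<^sub>1)" unfolding S_def using y(3) by blast
  then obtain q where q: "S q" "\<And>q'. S q' \<Longrightarrow> degree q \<le> degree q'"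
    using ex_has_least_nat[of S _ degree] by blast
  then obtain a and e :: nat where a: "a \<in> carrier A" "eps a = q" "a [^] e \<in> I" "q \<noteq> 0"
    unfolding S_def by blast
  have "a \<in> P" using prime_power_mem[OF P a(1)] a(3) I_P by blast
  obtain p where p: "P = dvd_ideal p" "\<not> p dvd 1" using prime_generator[OF P] by blast
  have "p dvd q" "p dvd eps y\<^sub>2"
    using \<open>a \<in> P\<close> y(2) a(2) unfolding p(1) dvd_ideal_def by blast+
  then obtain q' r where q': "q = p * q'" and r: "eps y\<^sub>2 = p * r" by (elim dvdE)
  have "(theta r \<otimes> a) [^] e \<in> I"
    using a I.I_l_closed by (simp add: nat_pow_distrib)
  moreover have "eps (y\<^sub>2 \<otimes> theta q') = eps (theta r \<otimes> a)"
    using y a r q' by (simp add: ac_simps)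
  ultimately obtain k :: nat where "(y\<^sub>2 \<otimes> theta q') [^] k \<in> I"
    using nil_congruent_power[OF I, of "y\<^sub>2 \<otimes> theta q'" "theta r \<otimes> a" e] y(4) a(1)
    by (meson m_closed theta_closed)
  then have "y\<^sub>2 [^] k \<otimes> theta q' [^] k \<in> I" using y by (simp add: nat_pow_distrib)
  then have "theta q' [^] k \<in> I"
    by (rule cancel_power[OF y(4) reg2, rotated 3]) simp_all
  moreover have "p \<noteq> 0" "q' \<noteq> 0" using q' a(4) by auto
  ultimately have "S q'" unfolding S_def using theta_closed eps_theta by blast
  then have "degree q \<le> degree q'" by (rule q(2))
  then have "degree p = 0" using q' \<open>p \<noteq> 0\<close> \<open>q' \<noteq> 0\<close> by (simp add: degree_mult_eq)
  then have "p dvd 1" using \<open>p \<noteq> 0\<close> by (simp add: is_unit_iff_degree)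
  then show False using p by simp
qed

text \<open>
  Both depth and codimension of a maximal ideal are at most one, and the codimension is one.  At the
  origin, positive depth gives a nonzerodivisor \<open>y\<close> that is congruent to a multiple of \<open>x\<close> modulo
  nilpotents; whatever \<open>x\<close> annihilates is annihilated by a power of \<open>y\<close>.  At the other maximal ideals
  the assumption \<open>line\<close> provides a nonzerodivisor.
\<close>

theorem cohen_macaulay_iff:
  assumes noetherian: "noetherian_ring A"
    and line: "nonzerodivisor (theta [:0, 1:]) \<Longrightarrow> (\<And>p. p \<noteq> 0 \<Longrightarrow> nonzerodivisor (theta p))"
  shows "cohen_macaulay A \<longleftrightarrow> nonzerodivisor (theta [:0, 1:])"
proof
  assume CM: "cohen_macaulay A"
  let ?M = "dvd_ideal [:0, 1:] :: 'a set"
  have depth: "ideal_depth A ?M = 1"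
    using CM maximalideal_origin prime_codim_maximal unfolding cohen_macaulay_def by simp
  have "\<exists>xs. regular_sequence A xs \<and> set xs \<subseteq> ?M \<and> xs \<noteq> []"
  proof (rule ccontr)
    assume "\<nexists>xs. regular_sequence A xs \<and> set xs \<subseteq> ?M \<and> xs \<noteq> []"
    then have "ideal_depth A ?M \<le> 0"
      unfolding ideal_depth_def by (intro Sup_least) (auto simp: zero_enat_def)
    then show False using depth by simp
  qed
  then obtain y ys where reg: "regular_sequence A (y # ys)" and y: "y \<in> ?M"
    by (metis list.exhaust list.set_intros(1) subsetD)
  have yc: "y \<in> carrier A" using y by (simp add: dvd_ideal_def)
  have reg1: "z = \<zero>" if "z \<in> carrier A" "y \<otimes> z = \<zero>" for z
    using regular_sequence_cancel[OF reg, of 0 z] that by (simp add: genideal_empty)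
  have "[:0, 1:] dvd eps y" using y unfolding dvd_ideal_def by blast
  then obtain h where h: "eps y = [:0, 1:] * h" by (elim dvdE)
  show "nonzerodivisor (theta [:0, 1:])"
    unfolding nonzerodivisor_def
  proof (intro ballI impI)
    fix z
    assume z: "z \<in> carrier A" "theta [:0, 1:] \<otimes> z = \<zero>"
    let ?I = "{a \<in> carrier A. a \<otimes> z = \<zero>}" and ?c = "theta h \<otimes> theta [:0, 1:]"
    have "?c \<in> ?I" using z by (simp add: m_assoc)
    then have "?c [^] (1 :: nat) \<in> ?I" by simp
    then obtain k :: nat where "y [^] k \<in> ?I"
      using nil_congruent_power[OF annihilator_ideal[OF z(1)] yc, of ?c 1] h
      by (metis eps_simps(1) eps_theta m_closed mult.commute theta_closed)
    then have yk: "y [^] k \<otimes> z \<in> {\<zero>}" by simp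
    have "z \<in> {\<zero>}"
    proof (rule cancel_power[OF yc _ z(1) yk])
      show "z' \<in> {\<zero>}" if "z' \<in> carrier A" "y \<otimes> z' \<in> {\<zero>}" for z' using reg1 that by simp
    qed
    then show "z = \<zero>" by simp
  qed
next
  assume X: "nonzerodivisor (theta [:0, 1:])"
  show "cohen_macaulay A"
    unfolding cohen_macaulay_def
  proof (intro conjI allI impI)
    fix P
    assume P: "maximalideal P A"
    note prime = maximalideal_prime[OF P]
    interpret P: maximalideal P A by fact
    obtain p where p: "P = dvd_ideal p" "\<not> p dvd 1" "p \<noteq> 0"
      by (rule maximal_generator[OF P])
    have mem: "theta p \<in> P" unfolding p(1) by (simp add: dvd_ideal_def)
    have "P \<subset> carrier A" using P.I_notcarr P.a_subset by blast
    moreover have "Idl {theta p} \<subseteq> P" using genideal_minimal[OF P.is_ideal] mem by simp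
    ultimately have "Idl {theta p} \<noteq> carrier A" by blast
    then have "regular_sequence A [theta p]"
      using line[OF X p(3)] unfolding regular_sequence_def nonzerodivisor_def
      by (simp add: genideal_empty)
    then have "enat (length [theta p]) \<le> ideal_depth A P"
      unfolding ideal_depth_def using mem by (intro Sup_upper) force
    then have "1 \<le> ideal_depth A P" by (simp add: one_enat_def)
    moreover have "ideal_depth A P \<le> 1"
      unfolding ideal_depth_def
    proof (rule Sup_least, safe)
      fix xs
      assume "regular_sequence A xs" "set xs \<subseteq> P"
      then show "enat (length xs) \<le> 1"
        using regular_sequence_length[OF prime] by (simp add: one_enat_def)
    qed
    ultimately show "ideal_depth A P = prime_codim A P"
      using prime_codim_maximal[OF P] by simp
  qed (use noetherian is_cring in auto)
qed

text \<open>
  The \<open>K[x]\<close>-submodule generated by a list.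
\<close>

primrec span :: "'a list \<Rightarrow> 'a set" where
  "span [] = {\<zero>}"
| "span (b # bs) = {theta p \<otimes> b \<oplus> s | p s. s \<in> span bs}"

lemma span_closed: "set bs \<subseteq> carrier A \<Longrightarrow> s \<in> span bs \<Longrightarrow> s \<in> carrier A"
  by (induction bs arbitrary: s) auto

lemma span_ConsI: "x = theta p \<otimes> b \<oplus> s \<Longrightarrow> s \<in> span bs \<Longrightarrow> x \<in> span (b # bs)"
  by auto

lemma span_zero: "set bs \<subseteq> carrier A \<Longrightarrow> \<zero> \<in> span bs"
proof (induction bs)
  case (Cons b bs)
  then show ?case by (intro span_ConsI[of _ 0 b \<zero>]) (simp_all add: theta_zero)
qed simp

lemma span_add:
  "set bs \<subseteq> carrier A \<Longrightarrow> s \<in> span bs \<Longrightarrow> t \<in> span bs \<Longrightarrow> s \<oplus> t \<in> span bs"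
proof (induction bs arbitrary: s t)
  case (Cons b bs)
  obtain p s' q t' where st: "s = theta p \<otimes> b \<oplus> s'" "s' \<in> span bs"
      "t = theta q \<otimes> b \<oplus> t'" "t' \<in> span bs"
    using Cons.prems by auto
  have c: "b \<in> carrier A" "s' \<in> carrier A" "t' \<in> carrier A" "theta p \<in> carrier A" "theta q \<in> carrier A"
    using Cons.prems(1) st span_closed[of bs] by simp_all
  have "s \<oplus> t = (theta p \<oplus> theta q) \<otimes> b \<oplus> (s' \<oplus> t')"
    unfolding st using c by algebra
  then have "s \<oplus> t = theta (p + q) \<otimes> b \<oplus> (s' \<oplus> t')" by (simp add: theta_simps)
  moreover have "s' \<oplus> t' \<in> span bs" using Cons st by simp
  ultimately show ?case by (rule span_ConsI)
qed simp

lemma span_scale: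
  "set bs \<subseteq> carrier A \<Longrightarrow> s \<in> span bs \<Longrightarrow> theta q \<otimes> s \<in> span bs"
proof (induction bs arbitrary: s)
  case (Cons b bs)
  obtain p s' where st: "s = theta p \<otimes> b \<oplus> s'" "s' \<in> span bs"
    using Cons.prems by auto
  have c: "b \<in> carrier A" "s' \<in> carrier A" "theta p \<in> carrier A" "theta q \<in> carrier A"
    using Cons.prems(1) st span_closed[of bs] by simp_all
  have "theta q \<otimes> s = (theta q \<otimes> theta p) \<otimes> b \<oplus> theta q \<otimes> s'"
    unfolding st using c by algebra
  then have "theta q \<otimes> s = theta (q * p) \<otimes> b \<oplus> theta q \<otimes> s'" by (simp add: theta_simps)
  moreover have "theta q \<otimes> s' \<in> span bs" using Cons st by simp
  ultimately show ?case by (rule span_ConsI)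
qed simp

lemma span_base: "set bs \<subseteq> carrier A \<Longrightarrow> b \<in> set bs \<Longrightarrow> b \<in> span bs"
proof (induction bs)
  case (Cons a bs)
  show ?case
  proof (cases "b = a")
    case True
    then have "b = theta 1 \<otimes> a \<oplus> \<zero>" using Cons.prems by (simp add: theta_simps)
    then show ?thesis using span_zero[of bs] Cons.prems by (intro span_ConsI[of _ 1 a \<zero>]) simp_all
  next
    case False
    then have "b \<in> span bs" using Cons by simp
    moreover have "a \<in> carrier A" "b \<in> carrier A" using Cons.prems by auto
    then have "b = theta 0 \<otimes> a \<oplus> b" by (simp add: theta_zero)
    ultimately show ?thesis by (intro span_ConsI)
  qed
qed simp

text \<open>
  The usual induction on the number of module generators: the coefficients of the first generator
  that occur in \<open>W\<close> form an ideal of \<open>K[x]\<close>, which is principal.  That \<open>F\<close> generates \<open>W\<close> is expressed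
  through the ideals containing \<open>F\<close>, in the form in which it is used for ideals \<open>W\<close>.
\<close>

lemma submodule_finitely_generated:
  assumes "set bs \<subseteq> carrier A" "W \<subseteq> span bs" "\<zero> \<in> W"
    and "\<And>s t. s \<in> W \<Longrightarrow> t \<in> W \<Longrightarrow> s \<oplus> t \<in> W" "\<And>s q. s \<in> W \<Longrightarrow> theta q \<otimes> s \<in> W"
  shows "\<exists>F. finite F \<and> F \<subseteq> W \<and> (\<forall>J. ideal J A \<longrightarrow> F \<subseteq> J \<longrightarrow> W \<subseteq> J)"
  using assms
proof (induction bs arbitrary: W)
  case Nil
  then show ?case by (intro exI[of _ "{\<zero>}"]) auto
next
  case (Cons b bs)
  note W_add = Cons.prems(4) and W_scale = Cons.prems(5)
  have b: "b \<in> carrier A" and bs: "set bs \<subseteq> carrier A" using Cons.prems(1) by simp_all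
  define L where "L = {p. \<exists>s\<in>span bs. theta p \<otimes> b \<oplus> s \<in> W}"
  have "\<exists>p\<in>L. \<forall>f\<in>L. p dvd f"
  proof (rule polynomial_ideal_generator)
    fix f g
    assume "f \<in> L"
    then obtain s where s: "s \<in> span bs" "theta f \<otimes> b \<oplus> s \<in> W" unfolding L_def by blast
    have sc: "s \<in> carrier A" using span_closed[OF bs s(1)] .
    have "theta g \<otimes> (theta f \<otimes> b \<oplus> s) = (theta g \<otimes> theta f) \<otimes> b \<oplus> theta g \<otimes> s"
      using sc b theta_closed[of f] theta_closed[of g] by algebra
    then have "theta (g * f) \<otimes> b \<oplus> theta g \<otimes> s \<in> W"
      using W_scale[OF s(2), of g] by (simp add: theta_simps)
    then show "g * f \<in> L" unfolding L_def using span_scale[OF bs s(1)] by blast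
    assume "g \<in> L"
    then obtain t where t: "t \<in> span bs" "theta g \<otimes> b \<oplus> t \<in> W" unfolding L_def by blast
    have tc: "t \<in> carrier A" using span_closed[OF bs t(1)] .
    have "(theta f \<otimes> b \<oplus> s) \<oplus> (theta g \<otimes> b \<oplus> t) = (theta f \<oplus> theta g) \<otimes> b \<oplus> (s \<oplus> t)"
      using sc tc b theta_closed[of f] theta_closed[of g] by algebra
    then have "theta (f + g) \<otimes> b \<oplus> (s \<oplus> t) \<in> W"
      using W_add[OF s(2) t(2)] by (simp add: theta_simps)
    then show "f + g \<in> L" unfolding L_def using span_add[OF bs s(1) t(1)] by blast
  next
    have "theta 0 \<otimes> b \<oplus> \<zero> \<in> W" using Cons.prems(3) b by (simp add: theta_zero)
    then show "0 \<in> L" unfolding L_def using span_zero[OF bs] by blast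
  qed
  then obtain p where p: "p \<in> L" "\<And>f. f \<in> L \<Longrightarrow> p dvd f" by blast
  then obtain s where s: "s \<in> span bs" "theta p \<otimes> b \<oplus> s \<in> W" unfolding L_def by blast
  let ?w = "theta p \<otimes> b \<oplus> s"
  have sc: "s \<in> carrier A" using span_closed[OF bs s(1)] .
  have "\<exists>F. finite F \<and> F \<subseteq> W \<inter> span bs \<and>
      (\<forall>J. ideal J A \<longrightarrow> F \<subseteq> J \<longrightarrow> W \<inter> span bs \<subseteq> J)"
    by (rule Cons.IH) (use bs Cons.prems span_zero span_add span_scale in auto)
  then obtain F where F: "finite F" "F \<subseteq> W \<inter> span bs"
    "\<And>J. ideal J A \<Longrightarrow> F \<subseteq> J \<Longrightarrow> W \<inter> span bs \<subseteq> J" by blast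
  have "W \<subseteq> J" if J: "ideal J A" "insert ?w F \<subseteq> J" for J
  proof
    fix w
    assume w: "w \<in> W"
    interpret J: ideal J A by fact
    obtain f t where t: "w = theta f \<otimes> b \<oplus> t" "t \<in> span bs" using w Cons.prems(2) by auto
    then have "f \<in> L" using w unfolding L_def by blast
    then obtain k where k: "f = p * k" using p(2) by (auto elim: dvdE)
    have tc: "t \<in> carrier A" using span_closed[OF bs t(2)] .
    define u where "u = t \<oplus> theta (- k) \<otimes> s"
    have cancel: "theta (p * k) \<oplus> theta (- k) \<otimes> theta p = \<zero>" "theta (- k) \<oplus> theta k = \<zero>"
      using theta_zero by (simp_all flip: theta_simps)
    have c: "theta p \<in> carrier A" "theta f \<in> carrier A" "theta k \<in> carrier A" "theta (- k) \<in> carrier A"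
      by simp_all
    have "w \<oplus> theta (- k) \<otimes> ?w = (theta f \<oplus> theta (- k) \<otimes> theta p) \<otimes> b \<oplus> u"
      unfolding t u_def using tc sc b c by algebra
    also have "\<dots> = u" using cancel(1) k b tc sc by (simp add: u_def)
    finally have u: "w \<oplus> theta (- k) \<otimes> ?w = u" .
    have "u \<in> W" unfolding u[symmetric] using W_add[OF w W_scale[OF s(2)]] .
    moreover have "u \<in> span bs"
      unfolding u_def using span_add[OF bs t(2) span_scale[OF bs s(1)]] .
    ultimately have "u \<in> J" using F(3)[OF J(1)] J(2) by blast
    moreover have "theta k \<otimes> ?w \<in> J" using J.I_l_closed J(2) by simp
    ultimately have "u \<oplus> theta k \<otimes> ?w \<in> J"
      using additive_subgroup.a_closed[OF ideal.axioms(1)[OF J(1)]] by simp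
    moreover have "u \<oplus> theta k \<otimes> ?w = w \<oplus> (theta (- k) \<oplus> theta k) \<otimes> ?w"
      unfolding u[symmetric] t using tc sc b c by algebra
    then have "u \<oplus> theta k \<otimes> ?w = w"
      unfolding cancel(2) using t tc sc b by simp
    ultimately show "w \<in> J" by simp
  qed
  then show ?case
    using F(1,2) s(2) by (intro exI[of _ "insert ?w F"]) auto
qed

theorem noetherian:
  assumes bs: "set bs \<subseteq> carrier A" "carrier A \<subseteq> span bs"
  shows "noetherian_ring A"
proof (rule noetherian_ringI)
  fix I
  assume I: "ideal I A"
  interpret I: ideal I A by fact
  note sub = ideal.axioms(1)[OF I]
  have sI: "I \<subseteq> carrier A" using I.Icarr by blast
  have "\<exists>F. finite F \<and> F \<subseteq> I \<and> (\<forall>J. ideal J A \<longrightarrow> F \<subseteq> J \<longrightarrow> I \<subseteq> J)"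
  proof (rule submodule_finitely_generated[OF bs(1)])
    show "I \<subseteq> span bs" using bs(2) sI by blast
  qed (simp_all add: additive_subgroup.zero_closed[OF sub] additive_subgroup.a_closed[OF sub]
      I.I_l_closed)
  then obtain F where F: "finite F" "F \<subseteq> I" "\<And>J. ideal J A \<Longrightarrow> F \<subseteq> J \<Longrightarrow> I \<subseteq> J" by blast
  have Fc: "F \<subseteq> carrier A" using F(2) sI by blast
  have "I = Idl F"
    using F(3)[OF genideal_ideal[OF Fc] genideal_self[OF Fc]] genideal_minimal[OF I F(2)] by blast
  then show "\<exists>F\<subseteq>carrier A. finite F \<and> I = Idl F" using F(1) Fc by blast
qed

end

section \<open>The tangent cone as a thickening of a coordinate axis\<close>

lemma minus_type_algebra [simp]: "a \<ominus>\<^bsub>ring_of_type_algebra\<^esub> b = a - (b :: 'a :: comm_ring_1)"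
proof -
  interpret R: ring "ring_of_type_algebra :: 'a ring" by rule
  have "\<ominus>\<^bsub>ring_of_type_algebra\<^esub> b = - b" by (rule R.minus_equality) auto
  then show ?thesis by (simp add: R.minus_eq)
qed

lemma quotient_type_algebra:
  fixes J :: "'a :: comm_ring_1 set"
  assumes "ideal J ring_of_type_algebra"
  defines "Q \<equiv> ring_of_type_algebra Quot J" and "cls \<equiv> (+>\<^bsub>ring_of_type_algebra\<^esub>) J"
  shows "cls \<in> ring_hom ring_of_type_algebra Q" "carrier Q = range cls"
    "cls f = cls g \<longleftrightarrow> f - g \<in> J" "cls f = \<zero>\<^bsub>Q\<^esub> \<longleftrightarrow> f \<in> J" "cring Q"
proof -
  show "cls \<in> ring_hom ring_of_type_algebra Q"
    unfolding cls_def Q_def by (rule ideal.rcos_ring_hom[OF assms(1)])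
  show "carrier Q = range cls"
    by (auto simp: cls_def Q_def FactRing_def A_RCOSETS_def')
  show eq: "cls f = cls g \<longleftrightarrow> f - g \<in> J" for f g
    using ring.quotient_eq_iff_same_a_r_cos[OF ring_from_type_algebra assms(1), of f g]
    by (simp add: cls_def)
  have "\<zero>\<^bsub>Q\<^esub> = J" by (simp add: Q_def FactRing_def)
  also have "J = cls 0"
    unfolding cls_def
    using ring.a_rcos_zero[OF ring_from_type_algebra assms(1)] ideal_type_algebraD(1)[OF assms(1)] by simp
  finally show "cls f = \<zero>\<^bsub>Q\<^esub> \<longleftrightarrow> f \<in> J" using eq[of f 0] by simp
  show "cring Q"
    unfolding Q_def by (rule ideal.quotient_is_cring[OF assms(1)]) (rule cring_from_type_algebra)
qed

locale lowest_weight_variable =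
  fixes n :: "'v :: finite \<Rightarrow> nat" and i\<^sub>0 :: 'v
  assumes weight_pos: "0 < n i\<^sub>0" and weight_lowest: "j \<noteq> i\<^sub>0 \<Longrightarrow> n i\<^sub>0 < n j"
begin

definition axis_power :: "nat \<Rightarrow> 'v \<Rightarrow>\<^sub>0 nat" where
  "axis_power k = Poly_Mapping.single i\<^sub>0 k"

definition off_axis_deg :: "('v \<Rightarrow>\<^sub>0 nat) \<Rightarrow> nat" where
  "off_axis_deg m = (\<Sum>j\<in>- {i\<^sub>0}. Poly_Mapping.lookup m j)"

lemma off_axis_deg_add [simp]: "off_axis_deg (u + v) = off_axis_deg u + off_axis_deg v"
  by (simp add: off_axis_deg_def lookup_add sum.distrib)

lemma off_axis_deg_zero_iff: "off_axis_deg m = 0 \<longleftrightarrow> m = axis_power (Poly_Mapping.lookup m i\<^sub>0)"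
proof
  assume "off_axis_deg m = 0"
  then have "Poly_Mapping.lookup m j = 0" if "j \<noteq> i\<^sub>0" for j
    using that by (simp add: off_axis_deg_def)
  then show "m = axis_power (Poly_Mapping.lookup m i\<^sub>0)"
    by (intro poly_mapping_eqI) (simp add: axis_power_def lookup_single when_def)
next
  assume "m = axis_power (Poly_Mapping.lookup m i\<^sub>0)"
  then have "Poly_Mapping.lookup m j = 0" if "j \<noteq> i\<^sub>0" for j
    using that by (metis axis_power_def lookup_single_not_eq)
  then show "off_axis_deg m = 0" by (simp add: off_axis_deg_def)
qed

lemma off_axis_deg_axis_power [simp]: "off_axis_deg (axis_power k) = 0"
  by (subst off_axis_deg_zero_iff) (simp add: axis_power_def)

lemma lookup_axis_power: "Poly_Mapping.lookup (axis_power k) i\<^sub>0 = k"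
  by (simp add: axis_power_def)

lemma off_axis_deg_zero [simp]: "off_axis_deg 0 = 0"
  by (simp add: off_axis_deg_def)

lemma axis_power_add: "axis_power (k + l) = axis_power k + axis_power l"
  by (simp add: axis_power_def single_add)

text \<open>
  Every variable other than \<open>i\<^sub>0\<close> contributes at least \<open>n i\<^sub>0 + 1\<close> to the weight.
\<close>

lemma weight_excess: "n i\<^sub>0 * mono_deg m + off_axis_deg m \<le> weighted_deg n m"
proof -
  have "n i\<^sub>0 * mono_deg m + off_axis_deg m =
      n i\<^sub>0 * Poly_Mapping.lookup m i\<^sub>0 + (\<Sum>j\<in>- {i\<^sub>0}. (n i\<^sub>0 + 1) * Poly_Mapping.lookup m j)"
    unfolding mono_deg_def off_axis_deg_def
    by (subst sum.remove[of UNIV i\<^sub>0])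
      (simp_all add: Compl_eq_Diff_UNIV algebra_simps sum.distrib sum_distrib_left)
  also have "\<dots> \<le> n i\<^sub>0 * Poly_Mapping.lookup m i\<^sub>0 + (\<Sum>j\<in>- {i\<^sub>0}. n j * Poly_Mapping.lookup m j)"
    using weight_lowest by (intro add_left_mono sum_mono mult_right_mono) (auto simp: Suc_le_eq)
  also have "\<dots> = weighted_deg n m"
    unfolding weighted_deg_def by (subst sum.remove[of UNIV i\<^sub>0]) (simp_all add: Compl_eq_Diff_UNIV)
  finally show ?thesis .
qed

text \<open>
  Among the monomials of weight \<open>n i\<^sub>0 * k\<close>, the power of the variable \<open>i\<^sub>0\<close> is the only one of degree
  \<open>k\<close>, and all others have smaller degree.
\<close>

lemma cone_class_axis_power:
  "cone_class n m = Some (n i\<^sub>0 * k) \<longleftrightarrow> m = axis_power k"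
proof
  assume "cone_class n m = Some (n i\<^sub>0 * k)"
  then have m: "top_monomial n m" "weighted_deg n m = n i\<^sub>0 * k"
    by (auto simp: cone_class_def split: if_splits)
  have "mono_deg (axis_power k) \<le> mono_deg m"
    using m unfolding top_monomial_def by (metis weighted_deg_single axis_power_def)
  then have "n i\<^sub>0 * k \<le> n i\<^sub>0 * mono_deg m" by (simp add: axis_power_def)
  then have "off_axis_deg m = 0" using weight_excess[of m] m(2) by linarith
  then have "m = axis_power (Poly_Mapping.lookup m i\<^sub>0)" by (simp add: off_axis_deg_zero_iff)
  moreover from this have "n i\<^sub>0 * Poly_Mapping.lookup m i\<^sub>0 = n i\<^sub>0 * k"
    using m(2) by (metis axis_power_def weighted_deg_single)
  then have "Poly_Mapping.lookup m i\<^sub>0 = k" using weight_pos by simp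
  ultimately show "m = axis_power k" by simp
next
  assume m: "m = axis_power k"
  have "mono_deg m' \<le> k" if "weighted_deg n m' = n i\<^sub>0 * k" for m'
  proof -
    have "n i\<^sub>0 * mono_deg m' \<le> n i\<^sub>0 * k" using weight_excess[of m'] that by linarith
    then show ?thesis using weight_pos by simp
  qed
  then show "cone_class n m = Some (n i\<^sub>0 * k)"
    by (simp add: m cone_class_def top_monomial_def axis_power_def)
qed

text \<open>
  The power \<open>n i\<^sub>0\<close> of the variable \<open>j\<close> and the power \<open>n j\<close> of the variable \<open>i\<^sub>0\<close> have the same weight,
  and the second has the larger degree.
\<close>

lemma cone_class_high_power:
  assumes "j \<noteq> i\<^sub>0" "n i\<^sub>0 \<le> Poly_Mapping.lookup m j"
  shows "cone_class n m = None"
proof -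
  have "\<not> top_monomial n (Poly_Mapping.single j (n i\<^sub>0))"
    unfolding top_monomial_def
    using weight_lowest[OF assms(1)]
    by (auto simp: mult.commute not_le intro!: exI[of _ "axis_power (n j)"] simp: axis_power_def)
  moreover have "m = (m - Poly_Mapping.single j (n i\<^sub>0)) + Poly_Mapping.single j (n i\<^sub>0)"
    by (intro poly_mapping_eqI)
      (use assms(2) in \<open>auto simp: lookup_add lookup_minus lookup_single when_def\<close>)
  ultimately show ?thesis using top_monomial_divisor unfolding cone_class_def by metis
qed

lemma cone_class_high_off_axis_deg:
  assumes "card (UNIV :: 'v set) * n i\<^sub>0 \<le> off_axis_deg m"
  shows "cone_class n m = None"
proof (rule ccontr)
  assume not_None: "cone_class n m \<noteq> None"
  have "off_axis_deg m \<le> (\<Sum>j\<in>- {i\<^sub>0}. n i\<^sub>0)"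
    unfolding off_axis_deg_def
  proof (rule sum_mono)
    show "Poly_Mapping.lookup m j \<le> n i\<^sub>0" if "j \<in> - {i\<^sub>0}" for j
      using cone_class_high_power[of j m] not_None that by (cases "n i\<^sub>0 \<le> Poly_Mapping.lookup m j") auto
  qed
  also have "\<dots> < card (UNIV :: 'v set) * n i\<^sub>0"
  proof -
    have "card (- {i\<^sub>0}) < card (UNIV :: 'v set)" by (rule psubset_card_mono) auto
    then show ?thesis using weight_pos by simp
  qed
  finally show False using assms by simp
qed

text \<open>
  The restriction of a polynomial to the coordinate axis of \<open>i\<^sub>0\<close>, and the inclusion of the
  polynomials in that variable alone.
\<close>

definition to_axis :: "('v, 'k :: field) mpoly \<Rightarrow> 'k poly" where
  "to_axis f = (\<Sum>m\<in>Poly_Mapping.keys f. if off_axis_deg m = 0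
     then Polynomial.monom (Poly_Mapping.lookup f m) (Poly_Mapping.lookup m i\<^sub>0) else 0)"

definition from_axis :: "'k :: field poly \<Rightarrow> ('v, 'k) mpoly" where
  "from_axis p = poly (map_poly (Poly_Mapping.single 0) p) (Poly_Mapping.single (axis_power 1) 1)"

lemma coeff_to_axis: "Polynomial.coeff (to_axis f) k = Poly_Mapping.lookup f (axis_power k)"
proof -
  have "Polynomial.coeff (to_axis f) k =
      (\<Sum>m\<in>Poly_Mapping.keys f. if m = axis_power k then Poly_Mapping.lookup f m else 0)"
    unfolding to_axis_def Polynomial.coeff_sum
  proof (rule sum.cong[OF refl])
    fix m
    have "off_axis_deg m = 0 \<and> Poly_Mapping.lookup m i\<^sub>0 = k \<longleftrightarrow> m = axis_power k"
    proof
      show "m = axis_power k" if "off_axis_deg m = 0 \<and> Poly_Mapping.lookup m i\<^sub>0 = k"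
        using that off_axis_deg_zero_iff[of m] by metis
      show "off_axis_deg m = 0 \<and> Poly_Mapping.lookup m i\<^sub>0 = k" if "m = axis_power k"
        unfolding that by (simp add: lookup_axis_power)
    qed
    then show "Polynomial.coeff (if off_axis_deg m = 0
        then Polynomial.monom (Poly_Mapping.lookup f m) (Poly_Mapping.lookup m i\<^sub>0) else 0) k =
      (if m = axis_power k then Poly_Mapping.lookup f m else 0)" by auto
  qed
  then show ?thesis by (simp add: in_keys_iff)
qed

lemma to_axis_add: "to_axis (f + g) = to_axis f + to_axis g"
  by (rule poly_eqI) (simp add: coeff_to_axis lookup_add)

lemma to_axis_diff: "to_axis (f - g) = to_axis f - to_axis g"
  by (rule poly_eqI) (simp add: coeff_to_axis lookup_minus)

lemma to_axis_single:
  "to_axis (Poly_Mapping.single m a) =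
    (if off_axis_deg m = 0 then Polynomial.monom a (Poly_Mapping.lookup m i\<^sub>0) else 0)"
  by (simp add: to_axis_def)

lemma to_axis_mult: "to_axis (f * g) = to_axis f * to_axis g"
proof (induction f rule: mpoly_induct)
  case (single u a)
  show ?case
    by (induction g rule: mpoly_induct)
      (simp_all add: to_axis_add distrib_left to_axis_single mult_single lookup_add mult_monom)
qed (simp add: to_axis_add distrib_right)

lemma to_axis_one: "to_axis 1 = 1"
  by (simp add: to_axis_single off_axis_deg_def flip: single_one)

lemma from_axis_zero [simp]: "from_axis 0 = 0"
  by (simp add: from_axis_def)

lemma from_axis_pCons:
  "from_axis (pCons a p) =
    Poly_Mapping.single 0 a + Poly_Mapping.single (axis_power 1) 1 * from_axis p"
  by (simp add: from_axis_def map_poly_pCons)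

lemma from_axis_add: "from_axis (p + q) = from_axis p + from_axis q"
  by (induction p q rule: poly_induct2) (simp_all add: from_axis_pCons single_add algebra_simps)

lemma from_axis_smult: "from_axis (Polynomial.smult a p) = Poly_Mapping.single 0 a * from_axis p"
  by (induction p) (simp_all add: from_axis_pCons mult_single algebra_simps)

lemma from_axis_mult: "from_axis (p * q) = from_axis p * from_axis q"
  by (induction p)
    (simp_all add: from_axis_add from_axis_smult from_axis_pCons algebra_simps)

lemma from_axis_one: "from_axis 1 = 1"
  by (simp add: one_pCons from_axis_pCons)

lemma from_axis_monom: "from_axis (Polynomial.monom a k) = Poly_Mapping.single (axis_power k) a"
proof (induction k)
  case 0
  show ?case by (simp add: monom_0 from_axis_pCons axis_power_def)
next
  case (Suc k)
  have "axis_power (Suc k) = axis_power 1 + axis_power k" using axis_power_add[of 1 k] by simp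
  then show ?case by (simp add: monom_Suc from_axis_pCons Suc.IH mult_single)
qed

lemma from_axis_sum: "from_axis (sum h S) = (\<Sum>i\<in>S. from_axis (h i))"
  by (induction S rule: infinite_finite_induct) (simp_all add: from_axis_add)

lemma from_axis_altdef:
  "from_axis p = (\<Sum>k\<le>degree p. Poly_Mapping.single (axis_power k) (Polynomial.coeff p k))"
  by (subst poly_as_sum_of_monoms[symmetric]) (simp only: from_axis_sum from_axis_monom)

lemma to_axis_from_axis: "to_axis (from_axis p) = p"
proof (induction p)
  case (pCons a p)
  then show ?case
    by (simp add: from_axis_pCons to_axis_add to_axis_mult to_axis_single lookup_axis_power
        monom_0 monom_Suc)
qed (simp add: to_axis_def)

lemma to_axis_congruence_ideal:
  assumes "f \<in> congruence_ideal (cone_class n)"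
  shows "to_axis f = 0"
proof (rule poly_eqI)
  fix k
  have "coeff_sum (\<lambda>m. cone_class n m = Some (n i\<^sub>0 * k)) f = 0"
    using assms by (simp add: congruence_ideal_def)
  then show "Polynomial.coeff (to_axis f) k = Polynomial.coeff 0 k"
    unfolding cone_class_axis_power coeff_to_axis
    by (subst (asm) coeff_sum_superset[of "Poly_Mapping.keys f"])
      (auto simp: in_keys_iff split: if_splits)
qed

text \<open>
  Each monomial of the \<open>e\<close>-th power of \<open>f\<close> has degree at least \<open>e\<close> in the variables other than \<open>i\<^sub>0\<close>,
  so for large \<open>e\<close> one of them has exponent at least \<open>n i\<^sub>0\<close>.
\<close>

lemma to_axis_nilpotent:
  assumes "to_axis f = 0"
  shows "f ^ (card (UNIV :: 'v set) * n i\<^sub>0) \<in> congruence_ideal (cone_class n)"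
proof -
  have keys: "1 \<le> off_axis_deg m" if m: "m \<in> Poly_Mapping.keys f" for m
  proof (rule ccontr)
    assume "\<not> 1 \<le> off_axis_deg m"
    then have "m = axis_power (Poly_Mapping.lookup m i\<^sub>0)"
      using off_axis_deg_zero_iff[of m] by simp
    then have "Poly_Mapping.lookup f m = 0"
      using coeff_to_axis[of f "Poly_Mapping.lookup m i\<^sub>0"] assms by simp
    then show False using m by (simp add: in_keys_iff)
  qed
  have power: "\<forall>m\<in>Poly_Mapping.keys (f ^ e). e \<le> off_axis_deg m" for e
  proof (induction e)
    case (Suc e)
    show ?case
    proof
      fix m
      assume "m \<in> Poly_Mapping.keys (f ^ Suc e)"
      then obtain u v where "m = u + v" "u \<in> Poly_Mapping.keys f" "v \<in> Poly_Mapping.keys (f ^ e)"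
        using keys_mult[of f "f ^ e"] by auto
      then show "Suc e \<le> off_axis_deg m" using keys[of u] Suc.IH by auto
    qed
  qed simp
  let ?e = "card (UNIV :: 'v set) * n i\<^sub>0"
  have "{m \<in> Poly_Mapping.keys (f ^ ?e). cone_class n m = Some s} = {}" for s
    using power[of ?e] cone_class_high_off_axis_deg by fastforce
  then have "coeff_sum (\<lambda>m. cone_class n m = Some s) (f ^ ?e) = 0" for s
    unfolding coeff_sum_def by (simp only: sum.empty)
  then show ?thesis by (simp add: congruence_ideal_def)
qed

text \<open>
  Multiplication by the variable \<open>i\<^sub>0\<close> sends nonzero monomials of the tangent cone to nonzero
  monomials.
\<close>

definition preserves_top :: bool where
  "preserves_top \<longleftrightarrow> (\<forall>m. top_monomial n m \<longrightarrow> top_monomial n (axis_power 1 + m))"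

lemma cone_class_shift:
  assumes preserves_top
  shows "cone_class n (axis_power k + m) = Some (s + n i\<^sub>0 * k) \<longleftrightarrow> cone_class n m = Some s"
proof -
  have "top_monomial n (axis_power k + m) \<longleftrightarrow> top_monomial n m"
  proof (induction k)
    case (Suc k)
    have "axis_power (Suc k) + m = axis_power 1 + (axis_power k + m)"
      using axis_power_add[of 1 k] by (simp add: add.assoc)
    then show ?case
      using assms Suc.IH top_monomial_divisor unfolding preserves_top_def by metis
  qed (simp add: axis_power_def)
  then show ?thesis by (auto simp: cone_class_def axis_power_def)
qed

text \<open>
  Let \<open>s\<close> be the highest weight that occurs in the image of \<open>f\<close> in the tangent cone.  As multiplication
  by the variable shifts weights without loss, the coefficient of the product in weight
  \<open>s + n i\<^sub>0 * degree p\<close> is the product of the leading coefficient of \<open>p\<close> and that of \<open>f\<close>.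
\<close>

lemma axis_nonzerodivisor:
  assumes H: preserves_top and p: "p \<noteq> 0"
    and mem: "from_axis p * f \<in> congruence_ideal (cone_class n)"
  shows "f \<in> congruence_ideal (cone_class n)"
proof (rule ccontr)
  let ?\<phi> = "\<lambda>s. coeff_sum (\<lambda>m. cone_class n m = Some s) f"
  assume "f \<notin> congruence_ideal (cone_class n)"
  then have nonempty: "{s. ?\<phi> s \<noteq> 0} \<noteq> {}" by (auto simp: congruence_ideal_def)
  have "{s. ?\<phi> s \<noteq> 0} \<subseteq> weighted_deg n ` Poly_Mapping.keys f"
  proof
    fix s
    assume "s \<in> {s. ?\<phi> s \<noteq> 0}"
    then have "{m \<in> Poly_Mapping.keys f. cone_class n m = Some s} \<noteq> {}"
      unfolding coeff_sum_def by (metis (mono_tags, lifting) mem_Collect_eq sum.empty)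
    then show "s \<in> weighted_deg n ` Poly_Mapping.keys f"
      by (auto simp: cone_class_def split: if_splits)
  qed
  then have finite: "finite {s. ?\<phi> s \<noteq> 0}" by (rule finite_subset) simp
  define s where "s = Max {s. ?\<phi> s \<noteq> 0}"
  have s: "?\<phi> s \<noteq> 0" using Max_in[OF finite nonempty] by (simp add: s_def)
  have above: "?\<phi> t = 0" if "s < t" for t
    using Max_ge[OF finite, of t] that by (auto simp: s_def)
  let ?d = "degree p"
  have "coeff_sum (\<lambda>m. cone_class n m = Some (s + n i\<^sub>0 * ?d)) (from_axis p * f) =
      (\<Sum>k\<le>?d. Polynomial.coeff p k * coeff_sum (\<lambda>m. cone_class n (axis_power k + m) = Some (s + n i\<^sub>0 * ?d)) f)"
    unfolding from_axis_altdef sum_distrib_right coeff_sum_sum coeff_sum_single_mult ..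
  also have "\<dots> = (\<Sum>k\<le>?d. Polynomial.coeff p k * ?\<phi> (s + n i\<^sub>0 * (?d - k)))"
  proof (rule sum.cong[OF refl])
    fix k
    assume "k \<in> {..?d}"
    then have "s + n i\<^sub>0 * ?d = (s + n i\<^sub>0 * (?d - k)) + n i\<^sub>0 * k"
      by (simp flip: distrib_left)
    then show "Polynomial.coeff p k * coeff_sum (\<lambda>m. cone_class n (axis_power k + m) = Some (s + n i\<^sub>0 * ?d)) f =
        Polynomial.coeff p k * ?\<phi> (s + n i\<^sub>0 * (?d - k))"
      by (simp only: cone_class_shift[OF H])
  qed
  also have "\<dots> = Polynomial.coeff p ?d * ?\<phi> (s + n i\<^sub>0 * (?d - ?d))"
    by (rule sum.remove[of _ ?d, THEN trans]) (use above weight_pos in \<open>auto intro!: sum.neutral\<close>)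
  also have "\<dots> \<noteq> 0" using s p by simp
  finally show False using mem by (simp add: congruence_ideal_def)
qed

text \<open>
  The tangent cone is a thickened line with reduction \<open>K[x]\<close>, \<open>x\<close> being the variable \<open>i\<^sub>0\<close>; as a module
  over \<open>K[x]\<close> it is generated by the finitely many monomials with all exponents below \<open>n i\<^sub>0\<close>.
\<close>

theorem cohen_macaulay_tangent_cone_iff:
  "cohen_macaulay_tangent_cone (curve_ideal n :: ('v, 'k :: field) mpoly set) \<longleftrightarrow> preserves_top"
proof -
  define J :: "('v, 'k) mpoly set" where "J = congruence_ideal (cone_class n)"
  have J: "ideal J ring_of_type_algebra"
    unfolding J_def by (rule ideal_congruence_ideal[OF monomial_congruence_cone_class])
  define A :: "('v, 'k) mpoly set ring" where "A = mpoly_ring Quot J"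
  define cls :: "('v, 'k) mpoly \<Rightarrow> ('v, 'k) mpoly set" where
    "cls = (+>\<^bsub>ring_of_type_algebra\<^esub>) J"
  note quotient = quotient_type_algebra[OF J, folded A_def cls_def]
  interpret A: cring A by (rule quotient(5))
  have cls_simps [simp]: "cls f \<in> carrier A" "cls f \<otimes>\<^bsub>A\<^esub> cls g = cls (f * g)"
    "cls f \<oplus>\<^bsub>A\<^esub> cls g = cls (f + g)" "\<one>\<^bsub>A\<^esub> = cls 1" for f g
    using ring_hom_closed[OF quotient(1), of f] ring_hom_mult[OF quotient(1), of f g]
      ring_hom_add[OF quotient(1), of f g] ring_hom_one[OF quotient(1)] by simp_all
  have cls_power: "cls f [^]\<^bsub>A\<^esub> e = cls (f ^ e)" for f and e :: nat
    by (induction e) (simp_all add: mult.commute)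
  have zero: "\<zero>\<^bsub>A\<^esub> = cls 0"
    using quotient(4)[of 0] ideal_type_algebraD(1)[OF J] by simp
  define eps where "eps C = to_axis (SOME f. cls f = C)" for C
  define theta where "theta p = cls (from_axis p)" for p :: "'k poly"
  have eps_cls [simp]: "eps (cls f) = to_axis f" for f
  proof -
    have "cls (SOME g. cls g = cls f) = cls f" by (rule someI) (rule refl)
    then have "(SOME g. cls g = cls f) - f \<in> J" by (simp add: quotient(3))
    then have "to_axis ((SOME g. cls g = cls f) - f) = 0"
      unfolding J_def by (rule to_axis_congruence_ideal)
    then show ?thesis by (simp add: eps_def to_axis_diff)
  qed
  interpret T: thickened_line A eps theta
  proof (unfold_locales)
    show "eps \<in> ring_hom A ring_of_type_algebra"
      by (rule ring_hom_memI)
        (auto simp: quotient(2) to_axis_mult to_axis_add to_axis_one)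
    show "theta \<in> ring_hom ring_of_type_algebra A"
      by (rule ring_hom_memI)
        (simp_all add: theta_def from_axis_mult from_axis_add from_axis_one)
    show "eps (theta p) = p" for p by (simp add: theta_def to_axis_from_axis)
    fix a
    assume "a \<in> carrier A" "eps a = 0"
    then obtain f where f: "a = cls f" "to_axis f = 0" unfolding quotient(2) by auto
    from to_axis_nilpotent[OF f(2)]
    show "\<exists>e :: nat. a [^]\<^bsub>A\<^esub> e = \<zero>\<^bsub>A\<^esub>"
      unfolding f(1) cls_power quotient(4) J_def by blast
  qed
  define M where "M = {m :: 'v \<Rightarrow>\<^sub>0 nat. \<forall>j. Poly_Mapping.lookup m j < n i\<^sub>0}"
  have "M \<subseteq> Poly_Mapping.lookup -` (UNIV \<rightarrow>\<^sub>E {..<n i\<^sub>0})"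
    by (auto simp: M_def PiE_def)
  moreover have "finite (Poly_Mapping.lookup -` (UNIV \<rightarrow>\<^sub>E {..<n i\<^sub>0}) :: ('v \<Rightarrow>\<^sub>0 nat) set)"
  proof (rule finite_vimageI)
    show "finite (UNIV \<rightarrow>\<^sub>E {..<n i\<^sub>0} :: ('v \<Rightarrow> nat) set)" by (rule finite_PiE) simp_all
    show "inj (Poly_Mapping.lookup :: ('v \<Rightarrow>\<^sub>0 nat) \<Rightarrow> 'v \<Rightarrow> nat)"
      by (rule injI) (rule poly_mapping_eqI, simp)
  qed
  ultimately have "finite M" by (rule finite_subset)
  then obtain ms where ms: "set ms = M" using finite_list by blast
  define bs where "bs = map (\<lambda>m. cls (Poly_Mapping.single m 1)) ms"
  have bs: "set bs \<subseteq> carrier A" by (auto simp: bs_def)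
  have "cls f \<in> T.span bs" for f
  proof (induction f rule: mpoly_induct)
    case (single m a)
    show ?case
    proof (cases "\<exists>j. j \<noteq> i\<^sub>0 \<and> n i\<^sub>0 \<le> Poly_Mapping.lookup m j")
      case True
      then have "Poly_Mapping.single m a \<in> J"
        unfolding J_def single_mem_congruence_ideal using cone_class_high_power by blast
      then have "cls (Poly_Mapping.single m a) = \<zero>\<^bsub>A\<^esub>" by (simp add: quotient(4))
      then show ?thesis using T.span_zero[OF bs] by simp
    next
      case False
      define m' where "m' = m - axis_power (Poly_Mapping.lookup m i\<^sub>0)"
      have lookup: "Poly_Mapping.lookup m' j = (if j = i\<^sub>0 then 0 else Poly_Mapping.lookup m j)" for j
        by (simp add: m'_def lookup_minus axis_power_def lookup_single when_def)
      then have "m' \<in> M" using False weight_pos by (auto simp: M_def not_le)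
      then have "cls (Poly_Mapping.single m' 1) \<in> set bs" by (simp add: bs_def ms)
      from T.span_scale[OF bs T.span_base[OF bs this]]
      have "theta (Polynomial.monom a (Poly_Mapping.lookup m i\<^sub>0)) \<otimes>\<^bsub>A\<^esub>
          cls (Poly_Mapping.single m' 1) \<in> T.span bs" .
      moreover
      have m: "axis_power (Poly_Mapping.lookup m i\<^sub>0) + m' = m"
        by (intro poly_mapping_eqI)
          (simp add: lookup lookup_add axis_power_def lookup_single when_def)
      have "theta (Polynomial.monom a (Poly_Mapping.lookup m i\<^sub>0)) \<otimes>\<^bsub>A\<^esub>
          cls (Poly_Mapping.single m' 1) = cls (Poly_Mapping.single m a)"
        by (simp add: theta_def from_axis_monom mult_single m)
      ultimately show ?thesis by simp
    qed
  next
    case (add f g)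
    then show ?case using T.span_add[OF bs] by (metis cls_simps(3))
  qed
  then have noetherian: "noetherian_ring A"
    by (intro T.noetherian[OF bs]) (auto simp: quotient(2))
  have nonzerodivisor: "A.nonzerodivisor (theta p) \<longleftrightarrow> (\<forall>f. from_axis p * f \<in> J \<longrightarrow> f \<in> J)" for p
    unfolding A.nonzerodivisor_def quotient(2) by (simp add: theta_def quotient(4))
  have X: "from_axis [:0, 1:] = (Poly_Mapping.single (axis_power 1) 1 :: ('v, 'k) mpoly)"
    by (simp add: from_axis_pCons)
  have line: "A.nonzerodivisor (theta p)" if "preserves_top" "p \<noteq> 0" for p
    using axis_nonzerodivisor[OF that] unfolding nonzerodivisor J_def by blast
  have "A.nonzerodivisor (theta [:0, 1:]) \<longleftrightarrow> preserves_top"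
  proof
    assume nzd: "A.nonzerodivisor (theta [:0, 1:])"
    show preserves_top
      unfolding preserves_top_def
    proof (intro allI impI)
      fix m
      assume m: "top_monomial n m"
      have "Poly_Mapping.single m (1 :: 'k) \<notin> J"
        using m by (simp add: J_def single_mem_congruence_ideal cone_class_def)
      then have "from_axis [:0, 1:] * Poly_Mapping.single m (1 :: 'k) \<notin> J"
        using nzd nonzerodivisor by blast
      then show "top_monomial n (axis_power 1 + m)"
        by (simp add: X mult_single J_def single_mem_congruence_ideal cone_class_def split: if_splits)
    qed
  next
    assume preserves_top
    then show "A.nonzerodivisor (theta [:0, 1:])" by (rule line) simp
  qed
  then have "cohen_macaulay A \<longleftrightarrow> preserves_top"
    using T.cohen_macaulay_iff[OF noetherian] line by blast
  then show ?thesis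
    unfolding cohen_macaulay_tangent_cone_def initial_ideal_curve_ideal A_def J_def .
qed

end

section \<open>Rewriting monomials of a fibre to a normal form\<close>

type_synonym quad = "nat \<times> nat \<times> nat \<times> nat"

lemma newman:
  assumes wf: "wfP (\<lambda>y x. r x y)"
    and local: "\<And>x y z. r x y \<Longrightarrow> r x z \<Longrightarrow> \<exists>u. r\<^sup>*\<^sup>* y u \<and> r\<^sup>*\<^sup>* z u"
  shows "r\<^sup>*\<^sup>* x y \<Longrightarrow> r\<^sup>*\<^sup>* x z \<Longrightarrow> \<exists>u. r\<^sup>*\<^sup>* y u \<and> r\<^sup>*\<^sup>* z u"
proof (induction x arbitrary: y z rule: wfp_induct_rule[OF wf])
  case (1 x)
  show ?case
  proof (cases "x = y \<or> x = z")
    case True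
    then show ?thesis using 1 by blast
  next
    case False
    obtain y' where y': "r x y'" "r\<^sup>*\<^sup>* y' y"
      using 1(2) False by (cases rule: converse_rtranclpE) auto
    obtain z' where z': "r x z'" "r\<^sup>*\<^sup>* z' z"
      using 1(3) False by (cases rule: converse_rtranclpE) auto
    obtain u where u: "r\<^sup>*\<^sup>* y' u" "r\<^sup>*\<^sup>* z' u"
      using local y'(1) z'(1) by blast
    obtain v where v: "r\<^sup>*\<^sup>* y v" "r\<^sup>*\<^sup>* u v"
      using "1.IH"[OF y'(1) y'(2) u(1)] by auto
    have "r\<^sup>*\<^sup>* z' v" using u(2) v(2) by simp
    then obtain w where "r\<^sup>*\<^sup>* v w" "r\<^sup>*\<^sup>* z w"
      using "1.IH"[OF z'(1) _ z'(2)] by blast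
    then show ?thesis using v(1) by (meson rtranclp_trans)
  qed
qed

text \<open>
  The equations between the weights say that the five binomials vanish on the curve.
\<close>

locale bresinsky_exponents =
  fixes n1 n2 n3 n4 a1 a2 a3 a4 a12 a13 a23 a24 a31 a34 a41 a42 :: nat
  assumes n: "0 < n1" "n1 < n2" "n2 < n3" "n3 < n4"
    and pos: "0 < a12" "a12 < a2" "0 < a13" "a13 < a3" "0 < a23" "a23 < a3" "0 < a24" "a24 < a4"
      "0 < a31" "a31 < a1" "0 < a34" "a34 < a4" "0 < a41" "a41 < a1" "0 < a42" "a42 < a2"
    and w1: "a1 * n1 = a12 * n2 + a13 * n3"
    and w2: "a2 * n2 = a23 * n3 + a24 * n4"
    and w3: "a3 * n3 = a31 * n1 + a34 * n4"
    and w4: "a4 * n4 = a41 * n1 + a42 * n2"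
    and w5: "a41 * n1 + a23 * n3 = a12 * n2 + a34 * n4"
    and a24_a34: "a24 < a34"
    and a13_a23: "a13 \<le> a23"
begin

lemma pos': "0 < a1" "0 < a2" "0 < a3" "0 < a4"
  using pos by linarith+

fun weight :: "quad \<Rightarrow> nat" where
  "weight (a, b, c, d) = a * n1 + b * n2 + c * n3 + d * n4"

fun total :: "quad \<Rightarrow> nat" where
  "total (a, b, c, d) = a + b + c + d"

definition top_order :: "quad \<Rightarrow> bool" where
  "top_order e \<longleftrightarrow> (\<forall>e'. weight e' = weight e \<longrightarrow> total e' \<le> total e)"

text \<open>
  Invariance under replacing one term of one of the five binomials by the other, inside an arbitrary
  monomial.
\<close>

definition move_invariant :: "(quad \<Rightarrow> bool) \<Rightarrow> bool" where
  "move_invariant P \<longleftrightarrow>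
    (\<forall>a b c d.
      P (a + a1, b, c, d) = P (a, b + a12, c + a13, d) \<and>
      P (a, b + a2, c, d) = P (a, b, c + a23, d + a24) \<and>
      P (a, b, c + a3, d) = P (a + a31, b, c, d + a34) \<and>
      P (a, b, c, d + a4) = P (a + a41, b + a42, c, d) \<and>
      P (a + a41, b, c + a23, d) = P (a, b + a12, c, d + a34))"

text \<open>
  Monomials are rewritten such that the exponent of the first variable never decreases.  The first
  five rules are the five binomials.  The first two of them overlap in
  \<open>x\<^sub>2 ^ a12 \<cdot> x\<^sub>3 ^ a23 \<cdot> x\<^sub>4 ^ a24\<close>, and the last rule joins the two results.
\<close>

inductive step :: "quad \<Rightarrow> quad \<Rightarrow> bool" where
  step1: "step (a, b + a12, c + a13, d) (a + a1, b, c, d)"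
| step2: "step (a, b, c + a23, d + a24) (a, b + a2, c, d)"
| step3: "step (a, b, c + a3, d) (a + a31, b, c, d + a34)"
| step4: "step (a, b, c, d + a4) (a + a41, b + a42, c, d)"
| step5: "step (a, b + a12, c, d + a34) (a + a41, b, c + a23, d)"
| step6: "step (a, b + a12 + a2, c, d) (a + a1, b, c + (a23 - a13), d + a24)"

lemma step_iff:
  "step (a, b, c, d) y \<longleftrightarrow>
    a12 \<le> b \<and> a13 \<le> c \<and> y = (a + a1, b - a12, c - a13, d) \<or>
    a23 \<le> c \<and> a24 \<le> d \<and> y = (a, b + a2, c - a23, d - a24) \<or>
    a3 \<le> c \<and> y = (a + a31, b, c - a3, d + a34) \<or>
    a4 \<le> d \<and> y = (a + a41, b + a42, c, d - a4) \<or>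
    a12 \<le> b \<and> a34 \<le> d \<and> y = (a + a41, b - a12, c + a23, d - a34) \<or>
    a12 + a2 \<le> b \<and> y = (a + a1, b - a12 - a2, c + (a23 - a13), d + a24)"
    (is "_ \<longleftrightarrow> ?r")
proof
  assume "step (a, b, c, d) y"
  then show ?r
    by cases simp_all
next
  assume ?r
  then show "step (a, b, c, d) y"
  proof (elim disjE conjE)
    assume "a12 \<le> b" "a13 \<le> c" "y = (a + a1, b - a12, c - a13, d)"
    then show ?thesis using step1[of a "b - a12" "c - a13" d] by simp
  next
    assume "a23 \<le> c" "a24 \<le> d" "y = (a, b + a2, c - a23, d - a24)"
    then show ?thesis using step2[of a b "c - a23" "d - a24"] by simp
  next
    assume "a3 \<le> c" "y = (a + a31, b, c - a3, d + a34)"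
    then show ?thesis using step3[of a b "c - a3" d] by simp
  next
    assume "a4 \<le> d" "y = (a + a41, b + a42, c, d - a4)"
    then show ?thesis using step4[of a b c "d - a4"] by simp
  next
    assume "a12 \<le> b" "a34 \<le> d" "y = (a + a41, b - a12, c + a23, d - a34)"
    then show ?thesis using step5[of a "b - a12" c "d - a34"] by simp
  next
    assume "a12 + a2 \<le> b" "y = (a + a1, b - a12 - a2, c + (a23 - a13), d + a24)"
    moreover from this obtain b' where "b = a12 + a2 + b'" by (metis le_Suc_ex)
    ultimately show ?thesis using step6[of a b' c d] by (simp add: add.commute add.left_commute)
  qed
qed

lemma step_weight: "step x y \<Longrightarrow> weight y = weight x"
proof (induction rule: step.induct)
  case (step6 a b c d)
  obtain e where e: "a23 = a13 + e" using a13_a23 le_Suc_ex by blast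
  show ?case using w1 w2 unfolding e by (simp add: algebra_simps)
qed (use w1 w2 w3 w4 w5 in \<open>simp_all add: algebra_simps\<close>)

lemma steps_weight: "step\<^sup>*\<^sup>* x y \<Longrightarrow> weight y = weight x"
  by (induction rule: rtranclp_induct) (auto dest: step_weight)

lemma coordinate_le_weight:
  assumes "weight (a, b, c, d) = W"
  shows "a \<le> W" "b \<le> W"
proof -
  have "a * n1 \<le> W" "b * n2 \<le> W" using assms by auto
  moreover have "a \<le> a * n1" "b \<le> b * n2" using n by simp_all
  ultimately show "a \<le> W" "b \<le> W" by linarith+
qed

text \<open>
  Each step except \<open>step2\<close> raises the first exponent, and \<open>step2\<close> keeps it and raises the second one;
  both exponents are bounded by the weight, which does not change.
\<close>

lemma wf_step: "wfP (\<lambda>y x. step x y)"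
proof -
  define f where "f = (\<lambda>e :: quad. weight e - fst e)"
  define g where "g = (\<lambda>e :: quad. weight e - fst (snd e))"
  have "{(y, x). step x y} \<subseteq> measures [f, g]"
  proof (safe)
    fix a b c d a' b' c' d'
    assume s: "step (a, b, c, d) (a', b', c', d')"
    have w: "weight (a', b', c', d') = weight (a, b, c, d)" using step_weight[OF s] .
    have "a < a' \<or> a = a' \<and> b < b'" using s pos unfolding step_iff by auto
    then show "((a', b', c', d'), (a, b, c, d)) \<in> measures [f, g]"
      using coordinate_le_weight[OF w] w by (auto simp: f_def g_def)
  qed
  then have "wf {(y, x). step x y}" by (rule wf_subset[OF wf_measures])
  then show ?thesis by (simp add: wfp_def)
qed

end

text \<open>
  That the five binomials generate the whole ideal of the curve means that their moves connect all
  monomials of the same weight.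
\<close>

locale generated_fibres = bresinsky_exponents +
  assumes connected: "\<And>P e e'. move_invariant P \<Longrightarrow> weight e = weight e' \<Longrightarrow> P e = P e'"
begin

text \<open>
  No term of the five binomials divides the monomial, so no move applies to it.
\<close>

lemma singleton_fibre:
  assumes "a < a1" "b < a2" "c < a3" "d < a4"
    and "b < a12 \<or> c < a13" "c < a23 \<or> d < a24" "a < a31 \<or> d < a34"
      "a < a41 \<or> b < a42" "a < a41 \<or> c < a23" "b < a12 \<or> d < a34"
    and w: "weight e = weight (a, b, c, d)"
  shows "e = (a, b, c, d)"
proof -
  have "move_invariant (\<lambda>x. x = (a, b, c, d))"
    unfolding move_invariant_def
  proof (intro allI conjI)
    fix a' b' c' d'
    show "((a' + a1, b', c', d') = (a, b, c, d)) = ((a', b' + a12, c' + a13, d') = (a, b, c, d))"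
      using assms(1,5) by auto
    show "((a', b' + a2, c', d') = (a, b, c, d)) = ((a', b', c' + a23, d' + a24) = (a, b, c, d))"
      using assms(2,6) by auto
    show "((a', b', c' + a3, d') = (a, b, c, d)) = ((a' + a31, b', c', d' + a34) = (a, b, c, d))"
      using assms(3,7) by auto
    show "((a', b', c', d' + a4) = (a, b, c, d)) = ((a' + a41, b' + a42, c', d') = (a, b, c, d))"
      using assms(4,8) by auto
    show "((a' + a41, b', c' + a23, d') = (a, b, c, d)) = ((a', b' + a12, c', d' + a34) = (a, b, c, d))"
      using assms(9,10) by auto
  qed
  from connected[OF this w] show ?thesis by simp
qed

lemma x2_power:
  assumes "b < a2" "weight e = b * n2"
  shows "e = (0, b, 0, 0)"
proof (rule singleton_fibre)
  show "weight e = weight (0, b, 0, 0)" using assms(2) by simp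
qed (simp_all add: pos pos' assms(1))

lemma x3_power:
  assumes "c < a3" "weight e = c * n3"
  shows "e = (0, 0, c, 0)"
proof (rule singleton_fibre)
  show "weight e = weight (0, 0, c, 0)" using assms(2) by simp
qed (simp_all add: pos pos' assms(1))

lemma x4_power:
  assumes "d < a4" "weight e = d * n4"
  shows "e = (0, 0, 0, d)"
proof (rule singleton_fibre)
  show "weight e = weight (0, 0, 0, d)" using assms(2) by simp
qed (simp_all add: pos pos' assms(1))

text \<open>
  Bresinsky's relations between the exponents.  If one of them failed, comparing the weight
  equations would give a power of one variable with the weight of another monomial, below the
  bound up to which such a power is alone in its fibre.
\<close>

lemma relation3: "a3 = a13 + a23" and relation1: "a1 = a31 + a41"
proof -
  have *: "a1 * n1 + a3 * n3 = (a31 + a41) * n1 + (a13 + a23) * n3"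
    using w1 w3 w5 by (simp add: algebra_simps)
  have no_cross: False if "p * n1 = q * n1 + e * n3" "0 < e" "e < a3" for p q e
  proof -
    have "q * n1 \<le> p * n1" using that(1) by linarith
    then have "q \<le> p" using n by simp
    then obtain k where "p = q + k" using le_Suc_ex by blast
    then have "weight (k, 0, 0, 0) = e * n3" using that(1) by (simp add: algebra_simps)
    from x3_power[OF that(3) this] that(2) show False by simp
  qed
  show eq: "a3 = a13 + a23"
  proof (rule linorder_cases[of a3 "a13 + a23"])
    assume "a3 < a13 + a23"
    then obtain e where e: "a13 + a23 = a3 + e" "0 < e" using less_imp_add_positive by metis
    then have "a1 * n1 = (a31 + a41) * n1 + e * n3" using * by (simp add: algebra_simps)
    moreover have "e < a3" using e pos by linarith
    ultimately show ?thesis using no_cross e(2) by blast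
  next
    assume "a13 + a23 < a3"
    then obtain e where e: "a3 = a13 + a23 + e" "0 < e" using less_imp_add_positive by metis
    then have "(a31 + a41) * n1 = a1 * n1 + e * n3" using * by (simp add: algebra_simps)
    moreover have "e < a3" using e pos by linarith
    ultimately show ?thesis using no_cross e(2) by blast
  qed simp
  show "a1 = a31 + a41" using * n unfolding eq by simp
qed

lemma relation2: "a2 = a12 + a42" and relation4: "a4 = a24 + a34"
proof -
  have *: "(a12 + a42) * n2 + a34 * n4 = a23 * n3 + a4 * n4"
    using w4 w5 by (simp add: algebra_simps)
  have "a2 \<le> a12 + a42"
  proof (rule ccontr)
    assume "\<not> a2 \<le> a12 + a42"
    then have lt: "a12 + a42 < a2" by simp
    obtain k where k: "a4 = a34 + k" using pos less_imp_add_positive by metis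
    have "weight (0, 0, a23, k) = (a12 + a42) * n2"
      using * unfolding k by (simp add: algebra_simps)
    from x2_power[OF lt this] show False using pos by simp
  qed
  then obtain j where j: "a12 + a42 = a2 + j" using le_Suc_ex by blast
  have **: "j * n2 + (a24 + a34) * n4 = a4 * n4"
    using * w2 unfolding j by (simp add: algebra_simps)
  then have "(a24 + a34) * n4 \<le> a4 * n4" by linarith
  then have "a24 + a34 \<le> a4" using n by simp
  then obtain k where k: "a4 = a24 + a34 + k" using le_Suc_ex by blast
  have "weight (0, j, 0, 0) = k * n4"
    using ** unfolding k by (simp add: algebra_simps)
  moreover have "k < a4" using k pos by linarith
  ultimately have "j = 0 \<and> k = 0" using x4_power[of k "(0, j, 0, 0)"] by simp
  then show "a2 = a12 + a42" "a4 = a24 + a34" using j k by simp_all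
qed

definition joinable :: "quad \<Rightarrow> quad \<Rightarrow> bool" where
  "joinable y z \<longleftrightarrow> (\<exists>u. step\<^sup>*\<^sup>* y u \<and> step\<^sup>*\<^sup>* z u)"

lemma joinable_refl: "y = z \<Longrightarrow> joinable y z"
  unfolding joinable_def by blast

lemma joinable_sym: "joinable y z \<Longrightarrow> joinable z y"
  unfolding joinable_def by blast

lemma joinable_left: "step y u \<Longrightarrow> u = z \<Longrightarrow> joinable y z"
  and joinable_right: "step z u \<Longrightarrow> y = u \<Longrightarrow> joinable y z"
  and joinable_both: "step y u \<Longrightarrow> step z v \<Longrightarrow> u = v \<Longrightarrow> joinable y z"
  unfolding joinable_def by blast+

lemma reduce1: "a12 \<le> b \<Longrightarrow> a13 \<le> c \<Longrightarrow> step (a, b, c, d) (a + a1, b - a12, c - a13, d)"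
  and reduce2: "a23 \<le> c \<Longrightarrow> a24 \<le> d \<Longrightarrow> step (a, b, c, d) (a, b + a2, c - a23, d - a24)"
  and reduce3: "a3 \<le> c \<Longrightarrow> step (a, b, c, d) (a + a31, b, c - a3, d + a34)"
  and reduce4: "a4 \<le> d \<Longrightarrow> step (a, b, c, d) (a + a41, b + a42, c, d - a4)"
  and reduce5: "a12 \<le> b \<Longrightarrow> a34 \<le> d \<Longrightarrow> step (a, b, c, d) (a + a41, b - a12, c + a23, d - a34)"
  and reduce6: "a12 + a2 \<le> b \<Longrightarrow>
    step (a, b, c, d) (a + a1, b - a12 - a2, c + (a23 - a13), d + a24)"
  unfolding step_iff by blast+

text \<open>
  Here \<open>yi\<close> is the result of applying the \<open>i\<close>-th rule to the monomial with exponents \<open>a, b, c, d\<close>.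
\<close>

context
  fixes a b c d :: nat and y1 y2 y3 y4 y5 y6 :: quad
  defines "y1 \<equiv> (a + a1, b - a12, c - a13, d)"
    and "y2 \<equiv> (a, b + a2, c - a23, d - a24)"
    and "y3 \<equiv> (a + a31, b, c - a3, d + a34)"
    and "y4 \<equiv> (a + a41, b + a42, c, d - a4)"
    and "y5 \<equiv> (a + a41, b - a12, c + a23, d - a34)"
    and "y6 \<equiv> (a + a1, b - a12 - a2, c + (a23 - a13), d + a24)"
begin

text \<open>
  The critical pairs of the rules.  Rules with coprime left-hand sides commute; in the other cases
  Bresinsky's relations make the results meet after at most one further step on either side.
\<close>

lemma overlaps:
  shows "a12 \<le> b \<Longrightarrow> a13 \<le> c \<Longrightarrow> a23 \<le> c \<Longrightarrow> a24 \<le> d \<Longrightarrow> joinable y1 y2"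
    and "a12 \<le> b \<Longrightarrow> a13 \<le> c \<Longrightarrow> a3 \<le> c \<Longrightarrow> joinable y1 y3"
    and "a12 \<le> b \<Longrightarrow> a13 \<le> c \<Longrightarrow> a4 \<le> d \<Longrightarrow> joinable y1 y4"
    and "a12 \<le> b \<Longrightarrow> a13 \<le> c \<Longrightarrow> a34 \<le> d \<Longrightarrow> joinable y1 y5"
    and "a12 \<le> b \<Longrightarrow> a13 \<le> c \<Longrightarrow> a12 + a2 \<le> b \<Longrightarrow> joinable y1 y6"
    and "a23 \<le> c \<Longrightarrow> a24 \<le> d \<Longrightarrow> a3 \<le> c \<Longrightarrow> joinable y2 y3"
    and "a23 \<le> c \<Longrightarrow> a24 \<le> d \<Longrightarrow> a4 \<le> d \<Longrightarrow> joinable y2 y4"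
    and "a23 \<le> c \<Longrightarrow> a24 \<le> d \<Longrightarrow> a12 \<le> b \<Longrightarrow> a34 \<le> d \<Longrightarrow> joinable y2 y5"
    and "a23 \<le> c \<Longrightarrow> a24 \<le> d \<Longrightarrow> a12 + a2 \<le> b \<Longrightarrow> joinable y2 y6"
    and "a3 \<le> c \<Longrightarrow> a4 \<le> d \<Longrightarrow> joinable y3 y4"
    and "a3 \<le> c \<Longrightarrow> a12 \<le> b \<Longrightarrow> a34 \<le> d \<Longrightarrow> joinable y3 y5"
    and "a3 \<le> c \<Longrightarrow> a12 + a2 \<le> b \<Longrightarrow> joinable y3 y6"
    and "a4 \<le> d \<Longrightarrow> a12 \<le> b \<Longrightarrow> a34 \<le> d \<Longrightarrow> joinable y4 y5"
    and "a4 \<le> d \<Longrightarrow> a12 + a2 \<le> b \<Longrightarrow> joinable y4 y6"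
    and "a12 \<le> b \<Longrightarrow> a34 \<le> d \<Longrightarrow> a12 + a2 \<le> b \<Longrightarrow> joinable y5 y6"
proof -
  \<comment> \<open>this removes the truncated subtraction \<open>a23 - a13\<close> and makes all results cancel to sums\<close>
  obtain e f where "a23 = a13 + e" "a34 = a24 + f"
    using le_Suc_ex[OF a13_a23] le_Suc_ex[OF less_imp_le[OF a24_a34]] by blast
  note exponents = relation1 relation2 relation3 relation4 this
  show "joinable y1 y2" if h: "a12 \<le> b" "a13 \<le> c" "a23 \<le> c" "a24 \<le> d"
  proof -
    obtain b' c' d' where "b = a12 + b'" "c = a23 + c'" "d = a24 + d'"
      using le_Suc_ex[OF h(1)] le_Suc_ex[OF h(3)] le_Suc_ex[OF h(4)] by blast
    then show ?thesis
      unfolding y1_def y2_def by (intro joinable_right[OF reduce6]) (simp_all add: exponents)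
  qed
  show "joinable y1 y3" if h: "a12 \<le> b" "a13 \<le> c" "a3 \<le> c"
  proof -
    obtain b' c' where "b = a12 + b'" "c = a3 + c'"
      using le_Suc_ex[OF h(1)] le_Suc_ex[OF h(3)] by blast
    then show ?thesis
      unfolding y1_def y3_def by (intro joinable_right[OF reduce5]) (simp_all add: exponents)
  qed
  show "joinable y1 y4" if h: "a12 \<le> b" "a13 \<le> c" "a4 \<le> d"
  proof -
    obtain b' c' d' where "b = a12 + b'" "c = a13 + c'" "d = a4 + d'"
      using le_Suc_ex[OF h(1)] le_Suc_ex[OF h(2)] le_Suc_ex[OF h(3)] by blast
    then show ?thesis
      unfolding y1_def y4_def by (intro joinable_both[OF reduce4 reduce1]) (simp_all add: exponents)
  qed
  show "joinable y1 y5" if h: "a12 \<le> b" "a13 \<le> c" "a34 \<le> d"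
  proof -
    obtain b' c' d' where "b = a12 + b'" "c = a13 + c'" "d = a34 + d'"
      using le_Suc_ex[OF h(1)] le_Suc_ex[OF h(2)] le_Suc_ex[OF h(3)] by blast
    then show ?thesis
      unfolding y1_def y5_def by (intro joinable_right[OF reduce3]) (simp_all add: exponents)
  qed
  show "joinable y1 y6" if h: "a12 \<le> b" "a13 \<le> c" "a12 + a2 \<le> b"
  proof -
    obtain b' c' where "b = a12 + a2 + b'" "c = a13 + c'"
      using le_Suc_ex[OF h(3)] le_Suc_ex[OF h(2)] by blast
    then show ?thesis
      unfolding y1_def y6_def by (intro joinable_right[OF reduce2]) (simp_all add: exponents)
  qed
  show "joinable y2 y3" if h: "a23 \<le> c" "a24 \<le> d" "a3 \<le> c"
  proof -
    obtain c' d' where "c = a3 + c'" "d = a24 + d'"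
      using le_Suc_ex[OF h(3)] le_Suc_ex[OF h(2)] by blast
    then show ?thesis
      unfolding y2_def y3_def by (intro joinable_both[OF reduce1 reduce4]) (simp_all add: exponents)
  qed
  show "joinable y2 y4" if h: "a23 \<le> c" "a24 \<le> d" "a4 \<le> d"
  proof -
    obtain c' d' where "c = a23 + c'" "d = a4 + d'"
      using le_Suc_ex[OF h(1)] le_Suc_ex[OF h(3)] by blast
    then show ?thesis
      unfolding y2_def y4_def by (intro joinable_left[OF reduce5]) (simp_all add: exponents)
  qed
  show "joinable y2 y5" if h: "a23 \<le> c" "a24 \<le> d" "a12 \<le> b" "a34 \<le> d"
  proof -
    obtain c' d' b' where "c = a23 + c'" "d = a34 + d'" "b = a12 + b'"
      using le_Suc_ex[OF h(1)] le_Suc_ex[OF h(4)] le_Suc_ex[OF h(3)] by blast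
    then show ?thesis
      unfolding y2_def y5_def by (intro joinable_both[OF reduce6 reduce3]) (simp_all add: exponents)
  qed
  show "joinable y2 y6" if h: "a23 \<le> c" "a24 \<le> d" "a12 + a2 \<le> b"
  proof -
    obtain c' d' b' where "c = a23 + c'" "d = a24 + d'" "b = a12 + a2 + b'"
      using le_Suc_ex[OF h(1)] le_Suc_ex[OF h(2)] le_Suc_ex[OF h(3)] by blast
    then show ?thesis
      unfolding y2_def y6_def by (intro joinable_both[OF reduce6 reduce2]) (simp_all add: exponents)
  qed
  show "joinable y3 y4" if h: "a3 \<le> c" "a4 \<le> d"
  proof -
    obtain c' d' where "c = a3 + c'" "d = a4 + d'"
      using le_Suc_ex[OF h(1)] le_Suc_ex[OF h(2)] by blast
    then show ?thesis
      unfolding y3_def y4_def by (intro joinable_both[OF reduce4 reduce3]) (simp_all add: exponents)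
  qed
  show "joinable y3 y5" if h: "a3 \<le> c" "a12 \<le> b" "a34 \<le> d"
  proof -
    obtain c' b' d' where "c = a3 + c'" "b = a12 + b'" "d = a34 + d'"
      using le_Suc_ex[OF h(1)] le_Suc_ex[OF h(2)] le_Suc_ex[OF h(3)] by blast
    then show ?thesis
      unfolding y3_def y5_def by (intro joinable_both[OF reduce5 reduce3]) (simp_all add: exponents)
  qed
  show "joinable y3 y6" if h: "a3 \<le> c" "a12 + a2 \<le> b"
  proof -
    obtain c' b' where "c = a3 + c'" "b = a12 + a2 + b'"
      using le_Suc_ex[OF h(1)] le_Suc_ex[OF h(2)] by blast
    then show ?thesis
      unfolding y3_def y6_def by (intro joinable_both[OF reduce6 reduce3]) (simp_all add: exponents)
  qed
  show "joinable y4 y5" if h: "a4 \<le> d" "a12 \<le> b" "a34 \<le> d"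
  proof -
    obtain d' b' where "d = a4 + d'" "b = a12 + b'"
      using le_Suc_ex[OF h(1)] le_Suc_ex[OF h(2)] by blast
    then show ?thesis
      unfolding y4_def y5_def by (intro joinable_right[OF reduce2]) (simp_all add: exponents)
  qed
  show "joinable y4 y6" if h: "a4 \<le> d" "a12 + a2 \<le> b"
  proof -
    obtain d' b' where "d = a4 + d'" "b = a12 + a2 + b'"
      using le_Suc_ex[OF h(1)] le_Suc_ex[OF h(2)] by blast
    then show ?thesis
      unfolding y4_def y6_def by (intro joinable_both[OF reduce6 reduce4]) (simp_all add: exponents)
  qed
  show "joinable y5 y6" if h: "a12 \<le> b" "a34 \<le> d" "a12 + a2 \<le> b"
  proof -
    obtain b' d' where "b = a12 + a2 + b'" "d = a34 + d'"
      using le_Suc_ex[OF h(3)] le_Suc_ex[OF h(2)] by blast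
    then show ?thesis
      unfolding y5_def y6_def by (intro joinable_both[OF reduce1 reduce4]) (simp_all add: exponents)
  qed
qed

lemma locally_confluent:
  assumes "step (a, b, c, d) y" "step (a, b, c, d) z"
  shows "joinable y z"
proof -
  note o = overlaps
  have d: "joinable x x" for x by (rule joinable_refl) simp
  have red: "step (a, b, c, d) x \<longleftrightarrow>
    a12 \<le> b \<and> a13 \<le> c \<and> x = y1 \<or> a23 \<le> c \<and> a24 \<le> d \<and> x = y2 \<or> a3 \<le> c \<and> x = y3 \<or>
    a4 \<le> d \<and> x = y4 \<or> a12 \<le> b \<and> a34 \<le> d \<and> x = y5 \<or> a12 + a2 \<le> b \<and> x = y6" for x
    unfolding step_iff y1_def y2_def y3_def y4_def y5_def y6_def by (rule refl)
  show ?thesis using assms unfolding red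
    by (elim disjE conjE) (simp_all add: d o joinable_sym[OF o(1)] joinable_sym[OF o(2)]
      joinable_sym[OF o(3)] joinable_sym[OF o(4)] joinable_sym[OF o(5)] joinable_sym[OF o(6)]
      joinable_sym[OF o(7)] joinable_sym[OF o(8)] joinable_sym[OF o(9)] joinable_sym[OF o(10)]
      joinable_sym[OF o(11)] joinable_sym[OF o(12)] joinable_sym[OF o(13)] joinable_sym[OF o(14)]
      joinable_sym[OF o(15)])
qed

end

definition normal :: "quad \<Rightarrow> bool" where
  "normal z \<longleftrightarrow> (\<forall>y. \<not> step z y)"

lemma reaches_normal: "\<exists>z. step\<^sup>*\<^sup>* x z \<and> normal z"
proof (induction x rule: wfp_induct_rule[OF wf_step])
  case (1 x)
  show ?case
  proof (cases "normal x")
    case False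
    then obtain y where "step x y" unfolding normal_def by blast
    then show ?thesis using 1 by (blast intro: converse_rtranclp_into_rtranclp)
  qed blast
qed

lemma step_same_normal_form:
  assumes "step x y" "normal z"
  shows "step\<^sup>*\<^sup>* x z \<longleftrightarrow> step\<^sup>*\<^sup>* y z"
proof
  assume xz: "step\<^sup>*\<^sup>* x z"
  have xy: "step\<^sup>*\<^sup>* x y" using assms(1) by blast
  have local: "\<exists>u. step\<^sup>*\<^sup>* v u \<and> step\<^sup>*\<^sup>* w u" if "step x' v" "step x' w" for x' v w
    using that locally_confluent[of "fst x'" "fst (snd x')" "fst (snd (snd x'))" "snd (snd (snd x'))"]
    unfolding joinable_def prod.collapse by blast
  have "\<exists>u. step\<^sup>*\<^sup>* y u \<and> step\<^sup>*\<^sup>* z u"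
    by (rule newman[where r = step, OF wf_step _ xy xz]) (rule local)
  then obtain u where "step\<^sup>*\<^sup>* y u" "step\<^sup>*\<^sup>* z u" by blast
  moreover from this(2) have "u = z"
    by (cases rule: converse_rtranclpE) (use assms(2) in \<open>auto simp: normal_def\<close>)
  ultimately show "step\<^sup>*\<^sup>* y z" by simp
qed (use assms in auto)

lemma fibre_same_normal_form:
  assumes "weight e = weight e'" "normal z"
  shows "step\<^sup>*\<^sup>* e z \<longleftrightarrow> step\<^sup>*\<^sup>* e' z"
proof -
  note s = step_same_normal_form[OF _ assms(2)]
  have "move_invariant (\<lambda>x. step\<^sup>*\<^sup>* x z)"
    unfolding move_invariant_def
    using s[OF step1] s[OF step2] s[OF step3] s[OF step4] s[OF step5] by auto
  from connected[OF this assms(1)] show ?thesis .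
qed

lemma step_shift: "step (a, b, c, d) (a', b', c', d') \<Longrightarrow> step (a + 1, b, c, d) (a' + 1, b', c', d')"
  unfolding step_iff by auto

lemma steps_shift:
  "step\<^sup>*\<^sup>* x y \<Longrightarrow> step\<^sup>*\<^sup>* (fst x + 1, snd x) (fst y + 1, snd y)"
proof (induction rule: rtranclp_induct)
  case (step y z)
  then show ?case using step_shift
    by (cases y; cases z) (auto intro: rtranclp.rtrancl_into_rtrancl)
qed simp

lemma normal_shift: "normal (a, b, c, d) \<Longrightarrow> normal (a + 1, b, c, d)"
  unfolding normal_def step_iff by blast

lemma degree1: "a12 + a13 \<le> a1"
proof -
  have "(a12 + a13) * n1 \<le> a12 * n2 + a13 * n3"
    using n unfolding add_mult_distrib by (intro add_mono mult_le_mono2) auto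
  then have "(a12 + a13) * n1 \<le> a1 * n1" using w1 by simp
  then show ?thesis using n by simp
qed

lemma degree2: "a23 + a24 \<le> a2"
proof -
  have "(a23 + a24) * n2 \<le> a23 * n3 + a24 * n4"
    using n unfolding add_mult_distrib by (intro add_mono mult_le_mono2) auto
  then have "(a23 + a24) * n2 \<le> a2 * n2" using w2 by simp
  then show ?thesis using n by simp
qed

lemma degree4: "a4 \<le> a41 + a42"
proof -
  have "a41 * n1 + a42 * n2 \<le> (a41 + a42) * n4"
    using n unfolding add_mult_distrib by (intro add_mono mult_le_mono2) auto
  then have "a4 * n4 \<le> (a41 + a42) * n4" using w4 by simp
  then show ?thesis using n by simp
qed

text \<open>
  For necessity, apply the condition repeatedly to a monomial without first variable that is alone
  in its fibre.  For sufficiency, the inequalities make every step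
  degree non-decreasing, so normal forms have the largest degree in their fibres, and they
  remain normal after multiplication with the first variable.
\<close>

theorem order_condition_iff:
  "(\<forall>a b c d. top_order (a, b, c, d) \<longrightarrow> top_order (a + 1, b, c, d)) \<longleftrightarrow>
     a3 \<le> a31 + a34 \<and> a12 + a34 \<le> a41 + a23 \<and> a2 + a12 \<le> a1 + (a23 - a13) + a24"
  (is "?top \<longleftrightarrow> ?ineqs")
proof
  assume top: ?top
  have shift: "top_order (a + k, b, c, d)" if "top_order (a, b, c, d)" for a b c d k
  proof (induction k)
    case (Suc k)
    then show ?case using top[rule_format, of "a + k" b c d] by simp
  qed (use that in simp)
  \<comment> \<open>a monomial alone in its fibre has the largest degree there, hence so have its products with powers of the first variable\<close>
  have single: "total e' \<le> k + total (0, b, c, d)"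
    if "\<And>e. weight e = weight (0, b, c, d) \<Longrightarrow> e = (0, b, c, d)"
      and "weight e' = weight (k, b, c, d)" for b c d k e'
  proof -
    have "top_order (0, b, c, d)" using that(1) unfolding top_order_def by auto
    from shift[OF this, of k] have "total e' \<le> total (k, b, c, d)"
      using that(2) unfolding top_order_def add_0 by blast
    then show ?thesis by simp
  qed
  have "total (0, 0, a3, 0) \<le> a31 + total (0, 0, 0, a34)"
  proof (rule single)
    show "e = (0, 0, 0, a34)" if "weight e = weight (0, 0, 0, a34)" for e
      using x4_power[of a34 e] pos that by simp
  qed (use w3 in simp)
  moreover have "total (0, a12, 0, a34) \<le> a41 + total (0, 0, a23, 0)"
  proof (rule single)
    show "e = (0, 0, a23, 0)" if "weight e = weight (0, 0, a23, 0)" for e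
      using x3_power[of a23 e] pos that by simp
  qed (use w5 in simp)
  moreover have "total (0, a2 + a12, 0, 0) \<le> a1 + total (0, 0, a23 - a13, a24)"
  proof (rule single)
    show "e = (0, 0, a23 - a13, a24)" if "weight e = weight (0, 0, a23 - a13, a24)" for e
      by (rule singleton_fibre[OF _ _ _ _ _ _ _ _ _ _ that]) (use pos pos' a24_a34 in simp_all)
    show "weight (0, a2 + a12, 0, 0) = weight (a1, 0, a23 - a13, a24)"
      using step_weight[OF step6[of 0 0 0 0]] by simp
  qed
  ultimately show ?ineqs by simp
next
  assume ineqs: ?ineqs
  have step_total: "total x \<le> total y" if "step x y" for x y
    using that by (induction rule: step.induct) (use ineqs degree1 degree2 degree4 in auto)
  have total_mono: "total x \<le> total y" if "step\<^sup>*\<^sup>* x y" for x y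
    using that by (induction rule: rtranclp_induct) (auto dest: step_total)
  show ?top
  proof (intro allI impI)
    fix a b c d
    assume t: "top_order (a, b, c, d)"
    obtain a' b' c' d' where z: "step\<^sup>*\<^sup>* (a, b, c, d) (a', b', c', d')" "normal (a', b', c', d')"
      using reaches_normal by (metis prod_cases4)
    have "total (a', b', c', d') \<le> total (a, b, c, d)"
      using t steps_weight[OF z(1)] unfolding top_order_def by blast
    have z': "step\<^sup>*\<^sup>* (a + 1, b, c, d) (a' + 1, b', c', d')" "normal (a' + 1, b', c', d')"
      using steps_shift[OF z(1)] normal_shift[OF z(2)] by auto
    show "top_order (a + 1, b, c, d)"
      unfolding top_order_def
    proof (intro allI impI)
      fix e
      assume "weight e = weight (a + 1, b, c, d)"
      then have "step\<^sup>*\<^sup>* e (a' + 1, b', c', d')"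
        using fibre_same_normal_form z' by blast
      then have "total e \<le> total (a' + 1, b', c', d')" by (rule total_mono)
      then show "total e \<le> total (a + 1, b, c, d)"
        using \<open>total (a', b', c', d') \<le> total (a, b, c, d)\<close> by simp
    qed
  qed
qed

end

section \<open>The curve in four-space\<close>

lemma UNIV_4': "(UNIV :: 4 set) = {1, 2, 3, 4}"
proof -
  have "card {1, 2, 3, 4 :: 4} = CARD(4)" by simp
  then show ?thesis using card_subset_eq[of UNIV "{1, 2, 3, 4 :: 4}"] by simp
qed

lemma all_4: "(\<forall>i :: 4. Q i) \<longleftrightarrow> Q 1 \<and> Q 2 \<and> Q 3 \<and> Q 4"
proof -
  have "(\<forall>i :: 4. Q i) \<longleftrightarrow> (\<forall>i \<in> {1, 2, 3, 4 :: 4}. Q i)" unfolding UNIV_4'[symmetric] by simp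
  then show ?thesis by simp
qed

fun monomial4 :: "quad \<Rightarrow> 4 \<Rightarrow>\<^sub>0 nat" where
  "monomial4 (a, b, c, d) = Poly_Mapping.single 1 a + Poly_Mapping.single 2 b +
     Poly_Mapping.single 3 c + Poly_Mapping.single 4 d"

definition exponents4 :: "(4 \<Rightarrow>\<^sub>0 nat) \<Rightarrow> quad" where
  "exponents4 m = (Poly_Mapping.lookup m 1, Poly_Mapping.lookup m 2,
     Poly_Mapping.lookup m 3, Poly_Mapping.lookup m 4)"

lemma exponents4_monomial4 [simp]: "exponents4 (monomial4 e) = e"
  by (cases e) (simp add: exponents4_def lookup_add lookup_single when_def)

lemma monomial4_exponents4 [simp]: "monomial4 (exponents4 m) = m"
proof (rule poly_mapping_eqI)
  have "\<forall>i. Poly_Mapping.lookup (monomial4 (exponents4 m)) i = Poly_Mapping.lookup m i"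
    unfolding all_4 by (simp add: exponents4_def lookup_add lookup_single when_def)
  then show "Poly_Mapping.lookup (monomial4 (exponents4 m)) i = Poly_Mapping.lookup m i" for i by blast
qed

lemma all_monomials: "(\<forall>m. Q m) \<longleftrightarrow> (\<forall>a b c d. Q (monomial4 (a, b, c, d)))"
  by (metis monomial4_exponents4 prod_cases4)

lemma mvar_power: "(mvar i :: ('v, 'k :: comm_ring_1) mpoly) ^ k = Poly_Mapping.single (Poly_Mapping.single i k) 1"
  by (induction k) (simp_all add: mvar_def mult_single flip: single_add)

theorem theorem3p20:
  fixes n :: "4 \<Rightarrow> nat"
    and I_C :: "(4, 'k :: field) mpoly set"
    and f1 f2 f3 f4 f5 :: "(4, 'k) mpoly"
    and a1 a2 a3 a4 a12 a13 a23 a24 a31 a34 a41 a42 :: nat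
  assumes "0 < n 1" "n 1 < n 2" "n 2 < n 3" "n 3 < n 4"
    and "Gcd (range n) = 1"
    and "I_C = curve_ideal n"
    and "\<not> complete_intersection I_C"
    and "gorenstein_curve n"
    and "0 < a12" "a12 < a2" "0 < a13" "a13 < a3" "0 < a23" "a23 < a3" "0 < a24" "a24 < a4"
    and "0 < a31" "a31 < a1" "0 < a34" "a34 < a4" "0 < a41" "a41 < a1" "0 < a42" "a42 < a2"
    and "f1 = mvar 1 ^ a1 - mvar 2 ^ a12 * mvar 3 ^ a13"
    and "f2 = mvar 2 ^ a2 - mvar 3 ^ a23 * mvar 4 ^ a24"
    and "f3 = mvar 3 ^ a3 - mvar 1 ^ a31 * mvar 4 ^ a34"
    and "f4 = mvar 4 ^ a4 - mvar 1 ^ a41 * mvar 2 ^ a42"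
    and "f5 = mvar 1 ^ a41 * mvar 3 ^ a23 - mvar 2 ^ a12 * mvar 4 ^ a34"
    and "minimally_generates {f1, f2, f3, f4, f5} I_C"
    and "a24 < a34"
    and "a13 \<le> a23"
  shows "cohen_macaulay_tangent_cone I_C \<longleftrightarrow>
           a3 \<le> a31 + a34 \<and>
           a12 + a34 \<le> a41 + a23 \<and>
           int a2 + int a12 \<le> int a1 + int a23 - int a13 + int a24"
proof -
  note n_mono = assms(1-4) and I_C = assms(6) and pos = assms(9-24) and f_def = assms(25-29)
    and generates = assms(30) and a24_a34 = assms(31) and a13_a23 = assms(32)
  let ?x = "\<lambda>e. Poly_Mapping.single (monomial4 e) (1 :: 'k)"
  define moves where "moves =
    {((a1, 0, 0, 0), (0, a12, a13, 0)), ((0, a2, 0, 0), (0, 0, a23, a24)),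
     ((0, 0, a3, 0), (a31, 0, 0, a34)), ((0, 0, 0, a4), (a41, a42, 0, 0)),
     ((a41, 0, a23, 0), (0, a12, 0, a34))}"
  have f: "f1 = ?x (a1, 0, 0, 0) - ?x (0, a12, a13, 0)" "f2 = ?x (0, a2, 0, 0) - ?x (0, 0, a23, a24)"
    "f3 = ?x (0, 0, a3, 0) - ?x (a31, 0, 0, a34)" "f4 = ?x (0, 0, 0, a4) - ?x (a41, a42, 0, 0)"
    "f5 = ?x (a41, 0, a23, 0) - ?x (0, a12, 0, a34)"
    by (simp_all add: f_def mvar_power mult_single)
  have Idl: "Idl\<^bsub>mpoly_ring\<^esub> {f1, f2, f3, f4, f5} = I_C"
    using generates by (simp add: minimally_generates_def)
  have binomial_mem: "?x e - ?x e' \<in> I_C \<longleftrightarrow>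
      weighted_deg n (monomial4 e) = weighted_deg n (monomial4 e')" for e e'
    unfolding I_C curve_ideal_eq binomial_mem_congruence_ideal by simp
  have "{f1, f2, f3, f4, f5} \<subseteq> I_C"
    unfolding Idl[symmetric] by (rule genideal_type_algebra(2))
  then have w: "a1 * n 1 = a12 * n 2 + a13 * n 3" "a2 * n 2 = a23 * n 3 + a24 * n 4"
    "a3 * n 3 = a31 * n 1 + a34 * n 4" "a4 * n 4 = a41 * n 1 + a42 * n 2"
    "a41 * n 1 + a23 * n 3 = a12 * n 2 + a34 * n 4"
    unfolding f insert_subset binomial_mem by (simp_all add: mult.commute)
  interpret E: bresinsky_exponents "n 1" "n 2" "n 3" "n 4" a1 a2 a3 a4 a12 a13 a23 a24 a31 a34 a41 a42
    by unfold_locales (fact n_mono pos w a24_a34 a13_a23)+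
  have weight: "weighted_deg n (monomial4 e) = E.weight e"
    and total: "mono_deg (monomial4 e) = E.total e" for e
    by (cases e; simp add: mult.commute)+
  have connected: "P e = P e'" if P: "E.move_invariant P" and "E.weight e = E.weight e'" for P e e'
  proof -
    have "P (exponents4 (m + monomial4 u)) = P (exponents4 (m + monomial4 v))"
      if "(u, v) \<in> moves" for m u v
      using that P unfolding moves_def E.move_invariant_def
      by (auto simp: exponents4_def lookup_add lookup_single when_def)
    moreover have "?x e - ?x e' \<in> Idl\<^bsub>ring_of_type_algebra\<^esub> ((\<lambda>(u, v). Poly_Mapping.single u 1 -
        Poly_Mapping.single v 1) ` (\<lambda>(u, v). (monomial4 u, monomial4 v)) ` moves)"
    proof -
      have "(\<lambda>(u, v). Poly_Mapping.single u 1 - Poly_Mapping.single v (1 :: 'k)) `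
          (\<lambda>(u, v). (monomial4 u, monomial4 v)) ` moves = {f1, f2, f3, f4, f5}"
        unfolding moves_def f by simp
      then show ?thesis using that(2) Idl binomial_mem[of e e'] weight by simp
    qed
    \<comment> \<open>summing coefficients over \<open>P\<close> annihilates the ideal, hence a difference of monomials of equal weight\<close>
    ultimately have "coeff_sum (\<lambda>m. P (exponents4 m)) (?x e - ?x e') = 0"
      by (intro coeff_sum_ideal_invariant) auto
    then show ?thesis by (auto split: if_splits)
  qed
  interpret E: generated_fibres "n 1" "n 2" "n 3" "n 4" a1 a2 a3 a4 a12 a13 a23 a24 a31 a34 a41 a42
    by unfold_locales (rule connected)
  have "\<forall>j. j \<noteq> 1 \<longrightarrow> n 1 < n j"
    unfolding all_4 using n_mono by simp
  then interpret L: lowest_weight_variable n 1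
    using n_mono by unfold_locales auto
  have top: "top_monomial n (monomial4 e) \<longleftrightarrow> E.top_order e" for e
    unfolding top_monomial_def E.top_order_def
    by (metis monomial4_exponents4 weight total)
  have "L.axis_power 1 + monomial4 (a, b, c, d) = monomial4 (a + 1, b, c, d)" for a b c d
    unfolding L.axis_power_def monomial4.simps single_add by (simp only: ac_simps)
  then have "L.preserves_top \<longleftrightarrow> (\<forall>a b c d. E.top_order (a, b, c, d) \<longrightarrow> E.top_order (a + 1, b, c, d))"
    unfolding L.preserves_top_def all_monomials by (simp only: top)
  also have "\<dots> \<longleftrightarrow> a3 \<le> a31 + a34 \<and> a12 + a34 \<le> a41 + a23 \<and> a2 + a12 \<le> a1 + (a23 - a13) + a24"
    by (rule E.order_condition_iff)
  also have "a2 + a12 \<le> a1 + (a23 - a13) + a24 \<longleftrightarrow>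
      int a2 + int a12 \<le> int a1 + int a23 - int a13 + int a24"
    using a13_a23 by linarith
  finally show ?thesis
    unfolding I_C L.cohen_macaulay_tangent_cone_iff .
qed

end
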